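(* Let $(s_n)$ be an $s$-numbers sequence and assume that the Banach spaces $X,Y$ both admit uniformly complemented copies of $\ell^2_n$ for each $n$. Then for every sequence $\{\varepsilon_n\}\in c_0$ there exists an approximable operator $T\in\mathcal{L}^{\mathcal{A}}(X,Y)$ such that $s_n(T)\neq\mathbf{O}(\varepsilon_n)$.
   Context: $\ell^2_n$ denotes $n$-dimensional Hilbert space. A Banach space $Z$ admits uniformly complemented copies of $\ell^2_n$ for each $n$ if there is a constant $C\ge1$ such that for every $n\in\mathbb{N}$ there are a subspace $E_n\subseteq Z$, a linear isomorphism $u_n:E_n\to\ell^2_n$ with $\max\{\|u_n\|,\|u_n^{-1}\|\}\le C$, and a projection $P_n:Z\to Z$ with $P_n(Z)=E_n$ and $\|P_n\|\le C$. $\mathcal{L}(X,Y)$ is the space of bounded linear operators from $X$ to $Y$. $\mathcal{L}^{\mathcal{A}}(X,Y)$, the space of approximable operators, is the closure in $\mathcal{L}(X,Y)$ (operator norm) of the finite-rank operators. An $s$-numbers sequence is a rule that associates to every bounded linear operator $T$ between Banach spaces a sequence $(s_n(T))_{n\ge1}$ of non-negative numbers such that, for all Banach spaces $X,Y,Z$: (i) $\|T\|=s_1(T)\ge s_2(T)\ge\cdots\ge0$; (ii) $s_{n+m-1}(T+S)\le s_n(T)+s_m(S)$ for $S,T\in\mathcal{L}(X,Y)$, $n,m\ge1$; (iii) $s_{n+m-1}(TS)\le s_n(T)s_m(S)$ for $S\in\mathcal{L}(X,Y)$, $T\in\mathcal{L}(Y,Z)$, $n,m\ge1$; (iv) $s_n(1_d:\ell_2^n\to\ell_2^n)=1$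 for the identity operator on $\ell_2^n$, $n\ge1$; (v) $s_n(T)=0$ if $\mathrm{rank}(T)<n$. $c_0$ is the space of real sequences converging to $0$. $s_n(T)=\mathbf{O}(\varepsilon_n)$ means that there is a constant $C$ with $s_n(T)\le C|\varepsilon_n|$ for all $n\in\mathbb{N}$. *)

theory Defs
  imports "HOL-Analysis.Analysis"
begin

text \<open>
  An s-numbers sequence is defined simultaneously on all operators between all Banach spaces.
  Since HOL cannot quantify over types inside a formula, Banach spaces are given here by explicit
  carriers \<open>vcarrier X :: 'a set\<close>, and ``all Banach spaces'' means all Banach spaces carried by a
  subset of one arbitrary type, which plays the role of a universe. The scalar field is any
  \<^class>\<open>real_normed_field\<close>, i.e. (up to isomorphism) the reals or the complex numbers.
\<close>

record ('k, 'a) nspace =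
  vcarrier :: "'a set"
  vzero :: 'a
  vadd :: "'a \<Rightarrow> 'a \<Rightarrow> 'a"
  vscale :: "'k \<Rightarrow> 'a \<Rightarrow> 'a"
  vnorm :: "'a \<Rightarrow> real"

locale normed_space =
  fixes X :: "('k::real_normed_field, 'a) nspace"
  assumes zero_closed: "vzero X \<in> vcarrier X"
    and add_closed: "\<lbrakk>x \<in> vcarrier X; y \<in> vcarrier X\<rbrakk> \<Longrightarrow> vadd X x y \<in> vcarrier X"
    and scale_closed: "x \<in> vcarrier X \<Longrightarrow> vscale X c x \<in> vcarrier X"
    and add_assoc: "\<lbrakk>x \<in> vcarrier X; y \<in> vcarrier X; z \<in> vcarrier X\<rbrakk>
      \<Longrightarrow> vadd X (vadd X x y) z = vadd X x (vadd X y z)"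
    and add_commute: "\<lbrakk>x \<in> vcarrier X; y \<in> vcarrier X\<rbrakk> \<Longrightarrow> vadd X x y = vadd X y x"
    and add_zero: "x \<in> vcarrier X \<Longrightarrow> vadd X (vzero X) x = x"
    and add_neg: "x \<in> vcarrier X \<Longrightarrow> vadd X x (vscale X (- 1) x) = vzero X"
    and scale_one: "x \<in> vcarrier X \<Longrightarrow> vscale X 1 x = x"
    and scale_scale: "x \<in> vcarrier X \<Longrightarrow> vscale X a (vscale X b x) = vscale X (a * b) x"
    and scale_add_left: "x \<in> vcarrier X \<Longrightarrow> vscale X (a + b) x = vadd X (vscale X a x) (vscale X b x)"
    and scale_add_right: "\<lbrakk>x \<in> vcarrier X; y \<in> vcarrier X\<rbrakk>
      \<Longrightarrow> vscale X a (vadd X x y) = vadd X (vscale X a x) (vscale X a y)"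
    and norm_nonneg: "x \<in> vcarrier X \<Longrightarrow> 0 \<le> vnorm X x"
    and norm_eq_zero: "x \<in> vcarrier X \<Longrightarrow> vnorm X x = 0 \<longleftrightarrow> x = vzero X"
    and norm_scale: "x \<in> vcarrier X \<Longrightarrow> vnorm X (vscale X a x) = norm a * vnorm X x"
    and norm_triangle: "\<lbrakk>x \<in> vcarrier X; y \<in> vcarrier X\<rbrakk>
      \<Longrightarrow> vnorm X (vadd X x y) \<le> vnorm X x + vnorm X y"

text \<open>
  The value off the carrier is fixed because \<^locale>\<open>Metric_space\<close> requires a metric to be
  nonnegative and symmetric on the whole type.
\<close>

definition vdist :: "('k::real_normed_field, 'a) nspace \<Rightarrow> 'a \<Rightarrow> 'a \<Rightarrow> real" where
  "vdist X x y = (if x \<in> vcarrier X \<and> y \<in> vcarrier X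
                  then vnorm X (vadd X x (vscale X (- 1) y)) else 0)"

locale banach_space = normed_space +
  assumes complete: "Metric_space.mcomplete (vcarrier X) (vdist X)"

definition linear_subspace :: "'a set \<Rightarrow> ('k::real_normed_field, 'a) nspace \<Rightarrow> bool" where
  "linear_subspace V X \<longleftrightarrow> V \<subseteq> vcarrier X \<and> vzero X \<in> V \<and>
     (\<forall>x\<in>V. \<forall>y\<in>V. vadd X x y \<in> V) \<and> (\<forall>c. \<forall>x\<in>V. vscale X c x \<in> V)"

abbreviation subspace_of :: "('k, 'a) nspace \<Rightarrow> 'a set \<Rightarrow> ('k, 'a) nspace" where
  "subspace_of X V \<equiv> X\<lparr>vcarrier := V\<rparr>"

text \<open>
  Operators are \<^const>\<open>extensional\<close> functions, so that equality of operators is equality on the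
  domain; accordingly they are composed with \<^const>\<open>compose\<close>.
\<close>

definition operators ::
  "('k::real_normed_field, 'a) nspace \<Rightarrow> ('k, 'b) nspace \<Rightarrow> ('a \<Rightarrow> 'b) set" where
  "operators X Y = {T \<in> vcarrier X \<rightarrow>\<^sub>E vcarrier Y.
     (\<forall>x\<in>vcarrier X. \<forall>y\<in>vcarrier X. T (vadd X x y) = vadd Y (T x) (T y)) \<and>
     (\<forall>c. \<forall>x\<in>vcarrier X. T (vscale X c x) = vscale Y c (T x)) \<and>
     (\<exists>K. \<forall>x\<in>vcarrier X. vnorm Y (T x) \<le> K * vnorm X x)}"

definition opnorm ::
  "('k::real_normed_field, 'a) nspace \<Rightarrow> ('k, 'b) nspace \<Rightarrow> ('a \<Rightarrow> 'b) \<Rightarrow> real" where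
  "opnorm X Y T = (SUP x\<in>{x \<in> vcarrier X. vnorm X x \<le> 1}. vnorm Y (T x))"

definition operator_space ::
  "('k::real_normed_field, 'a) nspace \<Rightarrow> ('k, 'b) nspace \<Rightarrow> ('k, 'a \<Rightarrow> 'b) nspace" where
  "operator_space X Y =
     \<lparr>vcarrier = operators X Y,
      vzero = (\<lambda>x\<in>vcarrier X. vzero Y),
      vadd = (\<lambda>S T. \<lambda>x\<in>vcarrier X. vadd Y (S x) (T x)),
      vscale = (\<lambda>c T. \<lambda>x\<in>vcarrier X. vscale Y c (T x)),
      vnorm = opnorm X Y\<rparr>"

abbreviation id_op :: "('k, 'a) nspace \<Rightarrow> 'a \<Rightarrow> 'a" where
  "id_op X \<equiv> (\<lambda>x\<in>vcarrier X. x)"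

definition lincomb :: "('k::real_normed_field, 'a) nspace \<Rightarrow> 'k list \<Rightarrow> 'a list \<Rightarrow> 'a" where
  "lincomb X cs bs = foldr (\<lambda>(c, b). vadd X (vscale X c b)) (zip cs bs) (vzero X)"

text \<open>The linear subspace \<open>V\<close> of \<open>X\<close> has a basis consisting of \<open>n\<close> vectors.\<close>

definition has_dim :: "('k::real_normed_field, 'a) nspace \<Rightarrow> 'a set \<Rightarrow> nat \<Rightarrow> bool" where
  "has_dim X V n \<longleftrightarrow> linear_subspace V X \<and>
     (\<exists>bs. length bs = n \<and> set bs \<subseteq> V \<and> (\<forall>v\<in>V. \<exists>!cs. length cs = n \<and> lincomb X cs bs = v))"

definition has_rank ::
  "('k::real_normed_field, 'a) nspace \<Rightarrow> ('k, 'b) nspace \<Rightarrow> ('a \<Rightarrow> 'b) \<Rightarrow> nat \<Rightarrow> bool" where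
  "has_rank X Y T r \<longleftrightarrow> has_dim Y (T ` vcarrier X) r"

definition finite_rank_operators ::
  "('k::real_normed_field, 'a) nspace \<Rightarrow> ('k, 'b) nspace \<Rightarrow> ('a \<Rightarrow> 'b) set" where
  "finite_rank_operators X Y = {T \<in> operators X Y. \<exists>r. has_rank X Y T r}"

definition approximable_operators ::
  "('k::real_normed_field, 'a) nspace \<Rightarrow> ('k, 'b) nspace \<Rightarrow> ('a \<Rightarrow> 'b) set" where
  "approximable_operators X Y =
     Metric_space.mtopology (operators X Y) (vdist (operator_space X Y))
       closure_of finite_rank_operators X Y"

definition ell2 :: "nat \<Rightarrow> ('k::real_normed_field, nat \<Rightarrow> 'k) nspace" where
  "ell2 n =
     \<lparr>vcarrier = {x. \<forall>i\<ge>n. x i = 0},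
      vzero = (\<lambda>i. 0),
      vadd = (\<lambda>x y i. x i + y i),
      vscale = (\<lambda>c x i. c * x i),
      vnorm = (\<lambda>x. L2_set (\<lambda>i. norm (x i)) {..<n})\<rparr>"

definition isometric :: "('k::real_normed_field, 'a) nspace \<Rightarrow> ('k, 'b) nspace \<Rightarrow> bool" where
  "isometric X Y \<longleftrightarrow> (\<exists>u\<in>operators X Y. bij_betw u (vcarrier X) (vcarrier Y) \<and>
     (\<forall>x\<in>vcarrier X. vnorm Y (u x) = vnorm X x))"

definition uniformly_complemented_ell2 :: "('k::real_normed_field, 'a) nspace \<Rightarrow> bool" where
  "uniformly_complemented_ell2 Z \<longleftrightarrow>
     (\<exists>C\<ge>1. \<forall>n\<ge>1. \<exists>E u v P.
        linear_subspace E Z \<and>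
        u \<in> operators (subspace_of Z E) (ell2 n) \<and>
        v \<in> operators (ell2 n) (subspace_of Z E) \<and>
        compose E v u = id_op (subspace_of Z E) \<and>
        compose (vcarrier (ell2 n)) u v = id_op (ell2 n) \<and>
        max (opnorm (subspace_of Z E) (ell2 n) u) (opnorm (ell2 n) (subspace_of Z E) v) \<le> C \<and>
        P \<in> operators Z Z \<and> compose (vcarrier Z) P P = P \<and>
        P ` vcarrier Z = E \<and> opnorm Z Z P \<le> C)"

text \<open>
  \<open>s X Y T n\<close> is the \<open>n\<close>-th s-number of \<open>T\<close> as an operator from \<open>X\<close> to \<open>Y\<close>; it is meaningful
  for \<open>n \<ge> 1\<close> only. As \<^const>\<open>ell2\<close> need not itself be carried by the type \<open>'a\<close>, its role in
  \<open>s_ell2\<close> is taken by its isometric copies in \<open>'a\<close>; \<open>s_norm\<close> and \<open>s_mult\<close> make s-numbers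
  invariant under isometric isomorphisms, so it does not matter which copy is used.
\<close>

locale s_numbers_sequence =
  fixes s :: "('k::real_normed_field, 'a) nspace \<Rightarrow> ('k, 'a) nspace \<Rightarrow> ('a \<Rightarrow> 'a) \<Rightarrow> nat \<Rightarrow> real"
  assumes s_norm: "\<lbrakk>banach_space X; banach_space Y; T \<in> operators X Y\<rbrakk>
      \<Longrightarrow> s X Y T 1 = opnorm X Y T"
    and s_antimono: "\<lbrakk>banach_space X; banach_space Y; T \<in> operators X Y; n \<ge> 1\<rbrakk>
      \<Longrightarrow> s X Y T (n + 1) \<le> s X Y T n"
    and s_nonneg: "\<lbrakk>banach_space X; banach_space Y; T \<in> operators X Y; n \<ge> 1\<rbrakk>
      \<Longrightarrow> 0 \<le> s X Y T n"
    and s_add: "\<lbrakk>banach_space X; banach_space Y; S \<in> operators X Y; T \<in> operators X Y;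
        n \<ge> 1; m \<ge> 1\<rbrakk>
      \<Longrightarrow> s X Y (vadd (operator_space X Y) T S) (n + m - 1) \<le> s X Y T n + s X Y S m"
    and s_mult: "\<lbrakk>banach_space X; banach_space Y; banach_space Z;
        S \<in> operators X Y; T \<in> operators Y Z; n \<ge> 1; m \<ge> 1\<rbrakk>
      \<Longrightarrow> s X Z (compose (vcarrier X) T S) (n + m - 1) \<le> s Y Z T n * s X Y S m"
    and s_ell2: "\<lbrakk>banach_space H; isometric H (ell2 n); n \<ge> 1\<rbrakk> \<Longrightarrow> s H H (id_op H) n = 1"
    and s_rank: "\<lbrakk>banach_space X; banach_space Y; T \<in> operators X Y; has_rank X Y T r; r < n\<rbrakk>
      \<Longrightarrow> s X Y T n = 0"

end

theory Submission imports Defs begin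

text \<open>
  If every approximable operator had s-numbers \<open>O(\<epsilon>\<^sub>n)\<close>, the closed sets
  \<open>F\<^sub>m = {T. \<forall>n. s\<^sub>n(T) \<le> m\<bar>\<epsilon>\<^sub>n\<bar>}\<close> would cover the complete space of approximable operators, so by
  Baire some \<open>F\<^sub>m\<close> contains a ball, which may be centred at a finite-rank operator \<open>T\<^sub>0\<close>. For a
  finite-rank \<open>S\<close> of small norm, additivity applied to \<open>S = (T\<^sub>0 + S) - T\<^sub>0\<close> gives
  \<open>s\<^bsub>2j-1\<^esub>(S) \<le> 2m\<bar>\<epsilon>\<^sub>j\<bar>\<close>. On the other hand, projecting \<open>X\<close> onto a complemented copy of \<open>\<ell>\<^sup>2\<^sub>n\<close> and
  embedding that into \<open>Y\<close> yields finite-rank operators of bounded norm through which the identity of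
  \<open>\<ell>\<^sup>2\<^sub>n\<close> factors, so their \<open>n\<close>-th s-numbers are bounded below. Since \<open>\<epsilon>\<^sub>j\<close> tends to 0, this is a
  contradiction.
\<close>

section \<open>Normed spaces on carriers\<close>

abbreviation vsub :: "('k::real_normed_field, 'a) nspace \<Rightarrow> 'a \<Rightarrow> 'a \<Rightarrow> 'a" where
  "vsub X x y \<equiv> vadd X x (vscale X (- 1) y)"

text \<open>Convergence is expressed through the norm alone, which suits direct estimates.
  Membership of the terms in the carrier is not included; lemmas that need it assume it
  separately.\<close>

definition vlim :: "('k::real_normed_field, 'a) nspace \<Rightarrow> (nat \<Rightarrow> 'a) \<Rightarrow> 'a \<Rightarrow> bool" where
  "vlim X \<sigma> x \<longleftrightarrow> x \<in> vcarrier X \<and> (\<lambda>n. vnorm X (vsub X (\<sigma> n) x)) \<longlonglongrightarrow> 0"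

definition vcauchy :: "('k::real_normed_field, 'a) nspace \<Rightarrow> (nat \<Rightarrow> 'a) \<Rightarrow> bool" where
  "vcauchy X \<sigma> \<longleftrightarrow> (\<forall>n. \<sigma> n \<in> vcarrier X) \<and>
     (\<forall>e>0. \<exists>N. \<forall>m\<ge>N. \<forall>n\<ge>N. vnorm X (vsub X (\<sigma> m) (\<sigma> n)) < e)"

context normed_space
begin

section \<open>Vector space algebra and norm inequalities\<close>

lemma add_left_commute:
  "\<lbrakk>x \<in> vcarrier X; y \<in> vcarrier X; z \<in> vcarrier X\<rbrakk>
    \<Longrightarrow> vadd X x (vadd X y z) = vadd X y (vadd X x z)"
  by (metis add_assoc add_commute)

lemmas add_ac = add_assoc add_commute add_left_commute

lemma add_zero_right: "x \<in> vcarrier X \<Longrightarrow> vadd X x (vzero X) = x"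
  by (metis add_commute add_zero zero_closed)

lemma scale_zero_left: "x \<in> vcarrier X \<Longrightarrow> vscale X 0 x = vzero X"
  using scale_add_left[of x 1 "- 1"] by (simp add: scale_one add_neg)

lemma scale_zero_right: "vscale X c (vzero X) = vzero X"
  by (metis mult_zero_right scale_scale scale_zero_left zero_closed)

lemma norm_zero: "vnorm X (vzero X) = 0"
  by (simp add: norm_eq_zero zero_closed)

lemmas closed = zero_closed add_closed scale_closed

lemma sub_add_cancel:
  assumes "x \<in> vcarrier X" "y \<in> vcarrier X"
  shows "vadd X y (vsub X x y) = x"
proof -
  have "vadd X y (vsub X x y) = vadd X x (vsub X y y)"
    using assms by (simp add: add_left_commute closed)
  then show ?thesis using assms by (simp add: add_neg add_zero_right)
qed

lemma add_sub_cancel: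
  assumes "x \<in> vcarrier X" "y \<in> vcarrier X"
  shows "vsub X (vadd X x y) x = y"
proof -
  have "vsub X (vadd X x y) x = vadd X y (vsub X x x)"
    using assms by (simp add: add_ac closed)
  then show ?thesis using assms by (simp add: add_neg add_zero_right)
qed

lemma sub_eq_zero_iff:
  assumes "x \<in> vcarrier X" "y \<in> vcarrier X"
  shows "vsub X x y = vzero X \<longleftrightarrow> x = y"
  by (metis assms sub_add_cancel add_neg add_zero_right)

lemma sub_trans:
  assumes "x \<in> vcarrier X" "y \<in> vcarrier X" "z \<in> vcarrier X"
  shows "vadd X (vsub X x y) (vsub X y z) = vsub X x z"
proof -
  have "vadd X (vsub X x y) (vsub X y z) = vadd X (vsub X x z) (vsub X y y)"
    using assms by (simp add: add_ac closed)
  then show ?thesis using assms by (simp add: add_neg add_zero_right closed)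
qed

lemma sub_add_add:
  assumes "x \<in> vcarrier X" "y \<in> vcarrier X" "x' \<in> vcarrier X" "y' \<in> vcarrier X"
  shows "vsub X (vadd X x y) (vadd X x' y') = vadd X (vsub X x x') (vsub X y y')"
  using assms by (simp add: scale_add_right add_ac closed)

lemma scale_sub:
  assumes "x \<in> vcarrier X" "y \<in> vcarrier X"
  shows "vscale X c (vsub X x y) = vsub X (vscale X c x) (vscale X c y)"
  using assms by (simp add: scale_add_right scale_scale closed mult.commute)

lemma norm_sub_commute:
  assumes "x \<in> vcarrier X" "y \<in> vcarrier X"
  shows "vnorm X (vsub X x y) = vnorm X (vsub X y x)"
proof -
  have "vsub X x y = vscale X (- 1) (vsub X y x)"
    using assms by (simp add: scale_add_right scale_scale scale_one add_commute closed)
  then show ?thesis using assms by (simp add: norm_scale closed)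
qed

lemma norm_sub_triangle:
  assumes "x \<in> vcarrier X" "y \<in> vcarrier X" "z \<in> vcarrier X"
  shows "vnorm X (vsub X x z) \<le> vnorm X (vsub X x y) + vnorm X (vsub X y z)"
  using norm_triangle[of "vsub X x y" "vsub X y z"] assms by (simp add: sub_trans closed)

lemma norm_le_norm_sub:
  assumes "x \<in> vcarrier X" "y \<in> vcarrier X"
  shows "vnorm X y \<le> vnorm X x + vnorm X (vsub X x y)"
  using norm_triangle[of x "vsub X y x"] assms
  by (simp add: sub_add_cancel norm_sub_commute[of x y] closed)

section \<open>The metric of the norm and sequential completeness\<close>

lemma Metric_space: "Metric_space (vcarrier X) (vdist X)"
proof
  show "0 \<le> vdist X x y" for x y
    by (simp add: vdist_def norm_nonneg closed)
  show "vdist X x y = vdist X y x" for x y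
    by (simp add: vdist_def norm_sub_commute)
  show "vdist X x y = 0 \<longleftrightarrow> x = y" if "x \<in> vcarrier X" "y \<in> vcarrier X" for x y
    using that by (simp add: vdist_def norm_eq_zero sub_eq_zero_iff closed)
  show "vdist X x z \<le> vdist X x y + vdist X y z"
    if "x \<in> vcarrier X" "y \<in> vcarrier X" "z \<in> vcarrier X" for x y z
    using that by (simp add: vdist_def norm_sub_triangle)
qed

sublocale M: Metric_space "vcarrier X" "vdist X"
  by (rule Metric_space)

lemma MCauchy_iff_vcauchy: "M.MCauchy \<sigma> \<longleftrightarrow> vcauchy X \<sigma>"
  unfolding M.MCauchy_def vcauchy_def vdist_def by (auto simp: image_subset_iff)

lemma limitin_iff_vlim:
  assumes "\<And>n. \<sigma> n \<in> vcarrier X"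
  shows "limitin M.mtopology \<sigma> x sequentially \<longleftrightarrow> vlim X \<sigma> x"
proof (cases "x \<in> vcarrier X")
  case True
  then have "(\<lambda>n. vdist X (\<sigma> n) x) = (\<lambda>n. vnorm X (vsub X (\<sigma> n) x))"
    using assms by (simp add: vdist_def)
  then show ?thesis
    using True assms by (simp add: M.limitin_metric_dist_null vlim_def)
next
  case False
  then show ?thesis by (simp add: vlim_def M.limitin_metric)
qed

text \<open>Reduces completeness to norms of differences, the form in which it is proved below for
  operator spaces and for renormed ranges.\<close>

lemma banach_space_iff: "banach_space X \<longleftrightarrow> (\<forall>\<sigma>. vcauchy X \<sigma> \<longrightarrow> (\<exists>x. vlim X \<sigma> x))"
proof -
  have "banach_space X \<longleftrightarrow> M.mcomplete"
    using normed_space_axioms by (simp add: banach_space_def banach_space_axioms_def)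
  also have "\<dots> \<longleftrightarrow> (\<forall>\<sigma>. vcauchy X \<sigma> \<longrightarrow> (\<exists>x. vlim X \<sigma> x))"
    unfolding M.mcomplete_def MCauchy_iff_vcauchy
    by (metis limitin_iff_vlim vcauchy_def)
  finally show ?thesis .
qed

section \<open>Limits and the vector operations\<close>

lemma vlim_bound:
  assumes "\<And>n. \<sigma> n \<in> vcarrier X" "x \<in> vcarrier X" "f \<longlonglongrightarrow> 0"
    and "\<And>n. vnorm X (vsub X (\<sigma> n) x) \<le> f n"
  shows "vlim X \<sigma> x"
  unfolding vlim_def
proof (intro conjI assms(2))
  show "(\<lambda>n. vnorm X (vsub X (\<sigma> n) x)) \<longlonglongrightarrow> 0"
    by (rule tendsto_sandwich[OF _ _ tendsto_const[of 0] assms(3)])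
      (use assms in \<open>auto simp: norm_nonneg closed\<close>)
qed

lemma vlim_unique:
  assumes \<sigma>: "\<And>n. \<sigma> n \<in> vcarrier X" and x: "vlim X \<sigma> x" and y: "vlim X \<sigma> y"
  shows "x = y"
  using assms M.limitin_metric_unique[of \<sigma> x sequentially y] by (simp add: limitin_iff_vlim)

lemma vlim_add:
  assumes \<sigma>: "\<And>n. \<sigma> n \<in> vcarrier X" "\<And>n. \<tau> n \<in> vcarrier X" and x: "vlim X \<sigma> x" and y: "vlim X \<tau> y"
  shows "vlim X (\<lambda>n. vadd X (\<sigma> n) (\<tau> n)) (vadd X x y)"
proof (rule vlim_bound)
  have xy: "x \<in> vcarrier X" "y \<in> vcarrier X" using x y by (auto simp: vlim_def)
  then show "vadd X x y \<in> vcarrier X" by (simp add: closed)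
  show "(\<lambda>n. vnorm X (vsub X (\<sigma> n) x) + vnorm X (vsub X (\<tau> n) y)) \<longlonglongrightarrow> 0"
    using x y by (auto simp: vlim_def intro: tendsto_add_zero)
  show "vnorm X (vsub X (vadd X (\<sigma> n) (\<tau> n)) (vadd X x y))
      \<le> vnorm X (vsub X (\<sigma> n) x) + vnorm X (vsub X (\<tau> n) y)" for n
    using \<sigma> xy by (simp add: sub_add_add norm_triangle closed)
qed (use \<sigma> in \<open>simp add: closed\<close>)

lemma vlim_scale:
  assumes \<sigma>: "\<And>n. \<sigma> n \<in> vcarrier X" and x: "vlim X \<sigma> x"
  shows "vlim X (\<lambda>n. vscale X c (\<sigma> n)) (vscale X c x)"
proof (rule vlim_bound)
  have xX: "x \<in> vcarrier X" using x by (auto simp: vlim_def)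
  then show "vscale X c x \<in> vcarrier X" by (simp add: closed)
  show "(\<lambda>n. norm c * vnorm X (vsub X (\<sigma> n) x)) \<longlonglongrightarrow> 0"
    using x by (auto simp: vlim_def intro: tendsto_mult_right_zero)
  show "vnorm X (vsub X (vscale X c (\<sigma> n)) (vscale X c x)) \<le> norm c * vnorm X (vsub X (\<sigma> n) x)" for n
    using \<sigma> xX by (simp add: scale_sub[symmetric] norm_scale closed)
qed (use \<sigma> in \<open>simp add: closed\<close>)

text \<open>By the triangle inequality the norm of the limit exceeds \<open>K\<close> by at most
  \<open>vnorm X (vsub X (\<sigma> n) x)\<close>, which tends to 0. Only large indices count, as is
  needed when one index of a Cauchy estimate goes to infinity.\<close>

lemma norm_vlim_le:
  assumes \<sigma>: "\<And>n. \<sigma> n \<in> vcarrier X" and x: "vlim X \<sigma> x" and le: "\<And>n. n \<ge> N \<Longrightarrow> vnorm X (\<sigma> n) \<le> K"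
  shows "vnorm X x \<le> K"
proof (rule LIMSEQ_le_const)
  show "(\<lambda>n. K + vnorm X (vsub X (\<sigma> n) x)) \<longlonglongrightarrow> K"
    using x tendsto_add[OF tendsto_const[of K], of "\<lambda>n. vnorm X (vsub X (\<sigma> n) x)" 0 sequentially]
    by (simp add: vlim_def)
  have "vnorm X x \<le> K + vnorm X (vsub X (\<sigma> n) x)" if "n \<ge> N" for n
    using norm_le_norm_sub[of "\<sigma> n" x] \<sigma> x le[OF that] by (force simp: vlim_def)
  then show "\<exists>N. \<forall>n\<ge>N. vnorm X x \<le> K + vnorm X (vsub X (\<sigma> n) x)" by blast
qed

lemma subspace_normed:
  assumes "linear_subspace V X"
  shows "normed_space (subspace_of X V)"
proof -
  have V: "V \<subseteq> vcarrier X" "vzero X \<in> V" "\<And>x y. x \<in> V \<Longrightarrow> y \<in> V \<Longrightarrow> vadd X x y \<in> V"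
    "\<And>c x. x \<in> V \<Longrightarrow> vscale X c x \<in> V" and "\<And>x. x \<in> V \<Longrightarrow> x \<in> vcarrier X"
    using assms by (auto simp: linear_subspace_def)
  then show ?thesis
    by unfold_locales (auto simp: add_ac add_zero add_zero_right add_neg scale_one scale_scale
        scale_add_left scale_add_right norm_nonneg norm_eq_zero norm_scale norm_triangle)
qed

end

section \<open>The Banach space of operators\<close>

lemma operatorsI:
  assumes "\<And>x. x \<in> vcarrier X \<Longrightarrow> T x \<in> vcarrier Y"
    and "\<And>x. x \<notin> vcarrier X \<Longrightarrow> T x = undefined"
    and "\<And>x y. \<lbrakk>x \<in> vcarrier X; y \<in> vcarrier X\<rbrakk> \<Longrightarrow> T (vadd X x y) = vadd Y (T x) (T y)"
    and "\<And>c x. x \<in> vcarrier X \<Longrightarrow> T (vscale X c x) = vscale Y c (T x)"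
    and "\<And>x. x \<in> vcarrier X \<Longrightarrow> vnorm Y (T x) \<le> K * vnorm X x"
  shows "T \<in> operators X Y"
  using assms unfolding operators_def PiE_def extensional_def by blast

lemma operatorsD:
  assumes "T \<in> operators X Y"
  shows "x \<in> vcarrier X \<Longrightarrow> T x \<in> vcarrier Y"
    and "x \<notin> vcarrier X \<Longrightarrow> T x = undefined"
    and "\<lbrakk>x \<in> vcarrier X; y \<in> vcarrier X\<rbrakk> \<Longrightarrow> T (vadd X x y) = vadd Y (T x) (T y)"
    and "x \<in> vcarrier X \<Longrightarrow> T (vscale X c x) = vscale Y c (T x)"
  using assms by (auto simp: operators_def)

lemma operators_eqI:
  assumes "S \<in> operators X Y" "T \<in> operators X Y" "\<And>x. x \<in> vcarrier X \<Longrightarrow> S x = T x"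
  shows "S = T"
  using assms by (metis ext operatorsD(2))

locale normed_pair = X: normed_space X + Y: normed_space Y
  for X :: "('k::real_normed_field, 'a) nspace" and Y :: "('k, 'b) nspace"
begin

section \<open>Operator norm estimates\<close>

lemma op_zero: "T \<in> operators X Y \<Longrightarrow> T (vzero X) = vzero Y"
  by (metis X.scale_zero_left X.zero_closed Y.scale_zero_left operatorsD(1,4))

text \<open>The unit ball contains the zero vector, so the supremum is over a nonempty set.
  Nonnegativity of \<open>K\<close> matters on the zero space, where a linear map satisfies the
  pointwise bound for every \<open>K\<close> but has norm 0.\<close>

lemma opnorm_le:
  assumes "0 \<le> K" "\<And>x. x \<in> vcarrier X \<Longrightarrow> vnorm Y (T x) \<le> K * vnorm X x"
  shows "opnorm X Y T \<le> K"
  unfolding opnorm_def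
proof (rule cSUP_least)
  show "{x \<in> vcarrier X. vnorm X x \<le> 1} \<noteq> {}"
    using X.zero_closed X.norm_zero by force
  fix x assume x: "x \<in> {x \<in> vcarrier X. vnorm X x \<le> 1}"
  then have "K * vnorm X x \<le> K" using assms(1) by (simp add: mult_left_le)
  then show "vnorm Y (T x) \<le> K" using assms(2)[of x] x by simp
qed

lemma opnorm_upper:
  assumes T: "T \<in> operators X Y" and x: "x \<in> vcarrier X" "vnorm X x \<le> 1"
  shows "vnorm Y (T x) \<le> opnorm X Y T"
  unfolding opnorm_def
proof (rule cSUP_upper)
  obtain K where K: "\<And>x. x \<in> vcarrier X \<Longrightarrow> vnorm Y (T x) \<le> K * vnorm X x"
    using T unfolding operators_def by blast
  \<comment> \<open>The bound in \<open>operators\<close> carries no sign condition, so its constant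
    is replaced by the absolute value.\<close>
  have "vnorm Y (T x) \<le> \<bar>K\<bar>" if "x \<in> vcarrier X" "vnorm X x \<le> 1" for x
  proof -
    have "K * vnorm X x \<le> \<bar>K\<bar> * vnorm X x"
      using X.norm_nonneg that by (intro mult_right_mono) auto
    also have "\<dots> \<le> \<bar>K\<bar>" using that by (simp add: mult_left_le)
    finally show ?thesis using K[OF that(1)] by simp
  qed
  then show "bdd_above ((\<lambda>x. vnorm Y (T x)) ` {x \<in> vcarrier X. vnorm X x \<le> 1})"
    by (intro bdd_aboveI[of _ "\<bar>K\<bar>"]) auto
qed (use x in auto)

lemma opnorm_nonneg:
  assumes "T \<in> operators X Y" shows "0 \<le> opnorm X Y T"
proof -
  have "vnorm Y (T (vzero X)) = 0" by (simp add: op_zero[OF assms] Y.norm_zero)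
  then show ?thesis using opnorm_upper[OF assms X.zero_closed] X.norm_zero by simp
qed

lemma opnorm_bound:
  assumes T: "T \<in> operators X Y" and x: "x \<in> vcarrier X"
  shows "vnorm Y (T x) \<le> opnorm X Y T * vnorm X x"
proof (cases "x = vzero X")
  case True
  then show ?thesis by (simp add: op_zero[OF T] Y.norm_zero X.norm_zero)
next
  case False
  then have n: "vnorm X x > 0" using X.norm_nonneg[OF x] X.norm_eq_zero[OF x] by simp
  \<comment> \<open>Normalizing \<open>x\<close> to length 1 reduces the claim to the unit ball; the
    real factor has to be embedded into the scalar field.\<close>
  let ?c = "of_real (inverse (vnorm X x)) :: 'k"
  have "vnorm X (vscale X ?c x) = 1" using n x by (simp add: X.norm_scale norm_inverse)
  then have "vnorm Y (T (vscale X ?c x)) \<le> opnorm X Y T"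
    using T x by (intro opnorm_upper) (auto simp: X.closed)
  moreover have "vnorm Y (T (vscale X ?c x)) = inverse (vnorm X x) * vnorm Y (T x)"
    using x n by (simp add: operatorsD[OF T] Y.norm_scale norm_inverse)
  ultimately have "inverse (vnorm X x) * vnorm Y (T x) \<le> opnorm X Y T" by simp
  then show ?thesis using n by (simp add: field_simps)
qed

lemma opnorm_bound_le:
  assumes "T \<in> operators X Y" "x \<in> vcarrier X" "opnorm X Y T \<le> K"
  shows "vnorm Y (T x) \<le> K * vnorm X x"
  using opnorm_bound[OF assms(1,2)] mult_right_mono[OF assms(3) X.norm_nonneg[OF assms(2)]] by simp

lemma opnorm_zero_iff:
  assumes T: "T \<in> operators X Y"
  shows "opnorm X Y T = 0 \<longleftrightarrow> T = (\<lambda>x\<in>vcarrier X. vzero Y)"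
proof
  assume 0: "opnorm X Y T = 0"
  show "T = (\<lambda>x\<in>vcarrier X. vzero Y)"
  proof
    fix x
    have "T x = vzero Y" if "x \<in> vcarrier X"
      using opnorm_bound[OF T that] 0 Y.norm_nonneg[of "T x"] Y.norm_eq_zero[of "T x"]
        operatorsD(1)[OF T that] by simp
    then show "T x = (\<lambda>x\<in>vcarrier X. vzero Y) x" using operatorsD(2)[OF T] by auto
  qed
next
  assume "T = (\<lambda>x\<in>vcarrier X. vzero Y)"
  then have "opnorm X Y T \<le> 0" by (intro opnorm_le) (auto simp: Y.norm_zero)
  then show "opnorm X Y T = 0" using opnorm_nonneg[OF T] by simp
qed

section \<open>Pointwise vector space operations on operators\<close>

lemma operators_zero: "(\<lambda>x\<in>vcarrier X. vzero Y) \<in> operators X Y"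
  by (rule operatorsI[where K = 0])
    (auto simp: X.closed Y.closed Y.add_zero Y.scale_zero_right Y.norm_zero)

lemma operators_add_bound:
  assumes S: "S \<in> operators X Y" and T: "T \<in> operators X Y" and x: "x \<in> vcarrier X"
  shows "vnorm Y (vadd Y (S x) (T x)) \<le> (opnorm X Y S + opnorm X Y T) * vnorm X x"
  using Y.norm_triangle[OF operatorsD(1)[OF S x] operatorsD(1)[OF T x]]
    opnorm_bound[OF S x] opnorm_bound[OF T x]
  by (simp add: distrib_right)

lemma operators_add:
  assumes S: "S \<in> operators X Y" and T: "T \<in> operators X Y"
  shows "(\<lambda>x\<in>vcarrier X. vadd Y (S x) (T x)) \<in> operators X Y"
  by (rule operatorsI[where K = "opnorm X Y S + opnorm X Y T"])
    (use operators_add_bound[OF S T] in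
      \<open>auto simp: X.closed Y.closed operatorsD[OF S] operatorsD[OF T] Y.add_ac Y.scale_add_right\<close>)

lemma operators_scale:
  assumes T: "T \<in> operators X Y"
  shows "(\<lambda>x\<in>vcarrier X. vscale Y c (T x)) \<in> operators X Y"
  by (rule operatorsI[where K = "norm c * opnorm X Y T"])
    (use opnorm_bound[OF T] in \<open>auto simp: X.closed Y.closed operatorsD[OF T] Y.scale_add_right
        Y.scale_scale mult.commute mult.left_commute mult.assoc Y.norm_scale mult_left_mono\<close>)

lemma opnorm_add:
  assumes S: "S \<in> operators X Y" and T: "T \<in> operators X Y"
  shows "opnorm X Y (\<lambda>x\<in>vcarrier X. vadd Y (S x) (T x)) \<le> opnorm X Y S + opnorm X Y T"
  by (rule opnorm_le) (use operators_add_bound[OF S T] opnorm_nonneg S T in auto)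

lemma opnorm_scale_le:
  assumes T: "T \<in> operators X Y"
  shows "opnorm X Y (\<lambda>x\<in>vcarrier X. vscale Y c (T x)) \<le> norm c * opnorm X Y T"
  by (rule opnorm_le)
    (use opnorm_bound[OF T] opnorm_nonneg[OF T] in
      \<open>auto simp: operatorsD[OF T] Y.norm_scale mult.assoc mult_left_mono\<close>)

text \<open>Applying \<open>opnorm_scale_le\<close> to the inverse scalar gives the reverse
  inequality; the scalar 0 is treated apart.\<close>

lemma opnorm_scale:
  assumes T: "T \<in> operators X Y"
  shows "opnorm X Y (\<lambda>x\<in>vcarrier X. vscale Y c (T x)) = norm c * opnorm X Y T"
proof (cases "c = 0")
  case True
  then have "opnorm X Y (\<lambda>x\<in>vcarrier X. vscale Y c (T x)) = opnorm X Y (\<lambda>x\<in>vcarrier X. vzero Y)"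
    using operatorsD(1)[OF T] by (metis (mono_tags, lifting) Y.scale_zero_left restrict_ext)
  then show ?thesis using True opnorm_zero_iff[OF operators_zero] by simp
next
  case False
  let ?S = "\<lambda>x\<in>vcarrier X. vscale Y c (T x)"
  have "(\<lambda>x\<in>vcarrier X. vscale Y (inverse c) (?S x)) = T"
    by (rule operators_eqI[OF operators_scale[OF operators_scale[OF T]] T])
      (use False in \<open>auto simp: operatorsD[OF T] Y.scale_scale Y.scale_one\<close>)
  then have "opnorm X Y T \<le> inverse (norm c) * opnorm X Y ?S"
    using opnorm_scale_le[OF operators_scale[OF T], of "inverse c" c] by (simp add: norm_inverse)
  then have "norm c * opnorm X Y T \<le> opnorm X Y ?S" using False by (simp add: field_simps)
  then show ?thesis using opnorm_scale_le[OF T, of c] by simp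
qed

lemma normed_space_operator_space: "normed_space (operator_space X Y)"
  unfolding operator_space_def
  by unfold_locales
    (auto simp: operators_zero operators_add operators_scale opnorm_nonneg opnorm_zero_iff
        opnorm_scale opnorm_add operatorsD(1)[where X = X and Y = Y]
        operatorsD(2)[where X = X and Y = Y] Y.closed Y.add_zero Y.add_neg Y.scale_one
        Y.scale_scale Y.scale_add_left Y.scale_add_right Y.add_ac Y.add_zero_right fun_eq_iff)

sublocale L: normed_space "operator_space X Y"
  by (rule normed_space_operator_space)

lemma operator_space_simps:
  "vcarrier (operator_space X Y) = operators X Y"
  "vnorm (operator_space X Y) = opnorm X Y"
  "x \<in> vcarrier X \<Longrightarrow> vadd (operator_space X Y) S T x = vadd Y (S x) (T x)"
  "x \<in> vcarrier X \<Longrightarrow> vscale (operator_space X Y) c T x = vscale Y c (T x)"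
  by (auto simp: operator_space_def)

text \<open>A Cauchy sequence of operators is Cauchy at each point, so completeness of
  \<open>Y\<close> gives a pointwise limit. Letting one index of the Cauchy estimate tend to
  infinity yields an estimate proportional to the norm of \<open>x\<close>, which gives both
  boundedness of the limit and convergence in operator norm.\<close>

lemma banach_space_operator_space:
  assumes "banach_space Y"
  shows "banach_space (operator_space X Y)"
  unfolding L.banach_space_iff
proof (intro allI impI)
  fix \<sigma> assume "vcauchy (operator_space X Y) \<sigma>"
  then have \<sigma>: "\<And>n. \<sigma> n \<in> operators X Y" and
    Cauchy: "\<And>e. e > 0 \<Longrightarrow> \<exists>N. \<forall>m\<ge>N. \<forall>n\<ge>N. opnorm X Y (vsub (operator_space X Y) (\<sigma> m) (\<sigma> n)) < e"
    by (auto simp: vcauchy_def operator_space_simps)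
  have sub: "vsub (operator_space X Y) (\<sigma> m) (\<sigma> n) \<in> operators X Y" for m n
    using L.closed \<sigma> by (simp add: operator_space_simps)
  have \<sigma>Y: "\<sigma> n x \<in> vcarrier Y" if "x \<in> vcarrier X" for n x
    using operatorsD(1)[OF \<sigma> that] .
  have diff: "vnorm Y (vsub Y (\<sigma> m x) (\<sigma> n x)) \<le>
      opnorm X Y (vsub (operator_space X Y) (\<sigma> m) (\<sigma> n)) * vnorm X x" if "x \<in> vcarrier X" for m n x
    using opnorm_bound[OF sub that, of m n] that by (simp add: operator_space_simps)
  have Cauchyx: "\<exists>N. \<forall>m\<ge>N. \<forall>n\<ge>N. \<forall>x\<in>vcarrier X. vnorm Y (vsub Y (\<sigma> m x) (\<sigma> n x)) \<le> e * vnorm X x"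
    if e: "e > 0" for e
  proof -
    obtain N where N: "\<forall>m\<ge>N. \<forall>n\<ge>N. opnorm X Y (vsub (operator_space X Y) (\<sigma> m) (\<sigma> n)) < e"
      using Cauchy[OF e] by blast
    have "vnorm Y (vsub Y (\<sigma> m x) (\<sigma> n x)) \<le> e * vnorm X x"
      if "m \<ge> N" "n \<ge> N" "x \<in> vcarrier X" for m n x
      using diff[OF that(3), of m n] N that X.norm_nonneg[OF that(3)]
      by (meson less_imp_le mult_right_mono order_trans)
    then show ?thesis by blast
  qed
  have "\<exists>y. vlim Y (\<lambda>n. \<sigma> n x) y" if x: "x \<in> vcarrier X" for x
  proof -
    have "vcauchy Y (\<lambda>n. \<sigma> n x)"
      unfolding vcauchy_def
    proof (intro conjI allI impI \<sigma>Y[OF x])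
      fix e :: real assume "e > 0"
      \<comment> \<open>The summand 1 keeps the denominator positive when \<open>x\<close> is zero
        and makes the resulting bound strict.\<close>
      then have "e / (vnorm X x + 1) > 0" using X.norm_nonneg[OF x] by simp
      then obtain N where N: "\<forall>m\<ge>N. \<forall>n\<ge>N. \<forall>x'\<in>vcarrier X. vnorm Y (vsub Y (\<sigma> m x') (\<sigma> n x'))
            \<le> e / (vnorm X x + 1) * vnorm X x'"
        using Cauchyx by blast
      have "e / (vnorm X x + 1) * vnorm X x < e"
        using \<open>e > 0\<close> X.norm_nonneg[OF x] by (simp add: field_simps)
      then show "\<exists>N. \<forall>m\<ge>N. \<forall>n\<ge>N. vnorm Y (vsub Y (\<sigma> m x) (\<sigma> n x)) < e"
        using N x by (meson order_le_less_trans)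
    qed
    then show ?thesis using assms Y.banach_space_iff by blast
  qed
  then obtain T' where T': "\<And>x. x \<in> vcarrier X \<Longrightarrow> vlim Y (\<lambda>n. \<sigma> n x) (T' x)" by metis
  \<comment> \<open>Restriction makes the limit extensional, as membership in
    \<open>operators\<close> demands.\<close>
  define T where "T = restrict T' (vcarrier X)"
  have T: "vlim Y (\<lambda>n. \<sigma> n x) (T x)" if "x \<in> vcarrier X" for x
    using T' that by (simp add: T_def)
  have TY: "T x \<in> vcarrier Y" if "x \<in> vcarrier X" for x using T[OF that] by (simp add: vlim_def)
  have close: "\<exists>N. \<forall>n\<ge>N. \<forall>x\<in>vcarrier X. vnorm Y (vsub Y (\<sigma> n x) (T x)) \<le> e * vnorm X x"
    if "e > 0" for e
  proof -
    obtain N where N: "\<forall>m\<ge>N. \<forall>n\<ge>N. \<forall>x\<in>vcarrier X. vnorm Y (vsub Y (\<sigma> m x) (\<sigma> n x)) \<le> e * vnorm X x"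
      using Cauchyx[OF \<open>e > 0\<close>] by blast
    \<comment> \<open>The index \<open>n\<close> stays fixed while \<open>m\<close> grows; the bound
      passes to the limit by \<open>norm_vlim_le\<close>.\<close>
    have "vnorm Y (vsub Y (\<sigma> n x) (T x)) \<le> e * vnorm X x" if n: "n \<ge> N" and x: "x \<in> vcarrier X" for n x
    proof (rule Y.norm_vlim_le)
      have "vlim Y (\<lambda>m. \<sigma> n x) (\<sigma> n x)"
        by (rule Y.vlim_bound[where f = "\<lambda>_. 0"]) (auto simp: \<sigma>Y[OF x] Y.add_neg Y.norm_zero)
      then show "vlim Y (\<lambda>m. vsub Y (\<sigma> n x) (\<sigma> m x)) (vsub Y (\<sigma> n x) (T x))"
        using T[OF x] \<sigma>Y[OF x] by (intro Y.vlim_add Y.vlim_scale) (auto simp: Y.closed)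
      show "vsub Y (\<sigma> n x) (\<sigma> m x) \<in> vcarrier Y" for m using \<sigma>Y[OF x] by (simp add: Y.closed)
      show "vnorm Y (vsub Y (\<sigma> n x) (\<sigma> m x)) \<le> e * vnorm X x" if "m \<ge> N" for m
        using N n x that by blast
    qed
    then show ?thesis by blast
  qed
  have "T \<in> operators X Y"
  proof -
    obtain N where N: "\<forall>n\<ge>N. \<forall>x\<in>vcarrier X. vnorm Y (vsub Y (\<sigma> n x) (T x)) \<le> 1 * vnorm X x"
      using close[of 1] by auto
    show ?thesis
    proof (rule operatorsI[where K = "opnorm X Y (\<sigma> N) + 1"])
      show "T x \<in> vcarrier Y" if "x \<in> vcarrier X" for x using TY[OF that] .
      show "T x = undefined" if "x \<notin> vcarrier X" for x using that by (simp add: T_def)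
      show "T (vadd X x y) = vadd Y (T x) (T y)" if xy: "x \<in> vcarrier X" "y \<in> vcarrier X" for x y
      proof (rule Y.vlim_unique)
        show "vlim Y (\<lambda>n. \<sigma> n (vadd X x y)) (T (vadd X x y))" using T xy by (simp add: X.closed)
        have "vlim Y (\<lambda>n. vadd Y (\<sigma> n x) (\<sigma> n y)) (vadd Y (T x) (T y))"
          using T xy \<sigma>Y by (intro Y.vlim_add)
        then show "vlim Y (\<lambda>n. \<sigma> n (vadd X x y)) (vadd Y (T x) (T y))"
          using operatorsD(3)[OF \<sigma>] xy by simp
      qed (use \<sigma>Y xy in \<open>auto simp: X.closed\<close>)
      show "T (vscale X c x) = vscale Y c (T x)" if x: "x \<in> vcarrier X" for c x
      proof (rule Y.vlim_unique)
        show "vlim Y (\<lambda>n. \<sigma> n (vscale X c x)) (T (vscale X c x))" using T x by (simp add: X.closed)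
        have "vlim Y (\<lambda>n. vscale Y c (\<sigma> n x)) (vscale Y c (T x))"
          using T x \<sigma>Y by (intro Y.vlim_scale)
        then show "vlim Y (\<lambda>n. \<sigma> n (vscale X c x)) (vscale Y c (T x))"
          using operatorsD(4)[OF \<sigma>] x by simp
      qed (use \<sigma>Y x in \<open>auto simp: X.closed\<close>)
      show "vnorm Y (T x) \<le> (opnorm X Y (\<sigma> N) + 1) * vnorm X x" if x: "x \<in> vcarrier X" for x
        using Y.norm_le_norm_sub[OF \<sigma>Y[OF x] TY[OF x], of N] opnorm_bound[OF \<sigma> x, of N] N x
        by (force simp: distrib_right)
    qed
  qed
  moreover have "(\<lambda>n. opnorm X Y (vsub (operator_space X Y) (\<sigma> n) T)) \<longlonglongrightarrow> 0"
  proof (rule LIMSEQ_I)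
    fix r :: real assume "r > 0"
    \<comment> \<open>The supremum only preserves a weak inequality, so half of \<open>r\<close> is
      used.\<close>
    then obtain N where N: "\<forall>n\<ge>N. \<forall>x\<in>vcarrier X. vnorm Y (vsub Y (\<sigma> n x) (T x)) \<le> r / 2 * vnorm X x"
      using close[of "r / 2"] by auto
    have "norm (opnorm X Y (vsub (operator_space X Y) (\<sigma> n) T) - 0) < r" if "n \<ge> N" for n
    proof -
      have "opnorm X Y (vsub (operator_space X Y) (\<sigma> n) T) \<le> r / 2"
        using N that \<open>r > 0\<close> by (intro opnorm_le) (auto simp: operator_space_simps)
      moreover have "0 \<le> opnorm X Y (vsub (operator_space X Y) (\<sigma> n) T)"
        using L.closed \<sigma> \<open>T \<in> operators X Y\<close> by (intro opnorm_nonneg) (simp add: operator_space_simps)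
      ultimately show ?thesis using \<open>r > 0\<close> by simp
    qed
    then show "\<exists>N. \<forall>n\<ge>N. norm (opnorm X Y (vsub (operator_space X Y) (\<sigma> n) T) - 0) < r" by blast
  qed
  ultimately show "\<exists>T. vlim (operator_space X Y) \<sigma> T"
    by (auto simp: vlim_def operator_space_simps)
qed

end

section \<open>Finite rank\<close>

text \<open>The span of a list that may be linearly dependent. The recursion adds one generator at a
  time, matching the induction in \<open>has_dim_of_fspan\<close>; \<open>fspan_lincomb\<close>
  identifies it with the linear combinations used in \<open>has_dim\<close>.\<close>

fun fspan :: "('k::real_normed_field, 'a) nspace \<Rightarrow> 'a list \<Rightarrow> 'a set" where
  "fspan X [] = {vzero X}"
| "fspan X (b # bs) = {vadd X (vscale X c b) w |c w. w \<in> fspan X bs}"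

lemma lincomb_simps:
  "lincomb X [] [] = vzero X"
  "lincomb X (c # cs) (b # bs) = vadd X (vscale X c b) (lincomb X cs bs)"
  by (simp_all add: lincomb_def)

lemma lincomb_in_linear_subspace:
  assumes "linear_subspace V X" "set bs \<subseteq> V" "length cs = length bs"
  shows "lincomb X cs bs \<in> V"
  using assms(3,2)
  by (induction cs bs rule: list_induct2)
    (use assms(1) in \<open>auto simp: lincomb_simps linear_subspace_def\<close>)

lemma linear_subspace_Int:
  "\<lbrakk>linear_subspace V X; linear_subspace W X\<rbrakk> \<Longrightarrow> linear_subspace (V \<inter> W) X"
  by (auto simp: linear_subspace_def)

section \<open>Spans and the dimension of their subspaces\<close>

context normed_space
begin

lemma linear_subspace_fspan:
  assumes "set bs \<subseteq> vcarrier X"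
  shows "linear_subspace (fspan X bs) X"
  using assms
proof (induction bs)
  case Nil
  then show ?case by (auto simp: linear_subspace_def closed add_zero scale_zero_right)
next
  case (Cons b bs)
  then have b: "b \<in> vcarrier X" and W: "fspan X bs \<subseteq> vcarrier X" "vzero X \<in> fspan X bs"
    "\<And>v w. v \<in> fspan X bs \<Longrightarrow> w \<in> fspan X bs \<Longrightarrow> vadd X v w \<in> fspan X bs"
    "\<And>c v. v \<in> fspan X bs \<Longrightarrow> vscale X c v \<in> fspan X bs"
    and WX: "\<And>v. v \<in> fspan X bs \<Longrightarrow> v \<in> vcarrier X"
    by (auto simp: linear_subspace_def)
  have mem: "vadd X (vscale X c b) v \<in> fspan X (b # bs)" if "v \<in> fspan X bs" for c v
    using that by auto
  have "vadd X (vadd X (vscale X c b) v) (vadd X (vscale X d b) w) \<in> fspan X (b # bs)"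
    if "v \<in> fspan X bs" "w \<in> fspan X bs" for c d v w
  proof -
    have "vadd X (vadd X (vscale X c b) v) (vadd X (vscale X d b) w)
        = vadd X (vscale X (c + d) b) (vadd X v w)"
      using that b WX by (simp add: scale_add_left add_ac closed)
    then show ?thesis using mem W(3)[OF that] by metis
  qed
  moreover have "vscale X d (vadd X (vscale X c b) v) \<in> fspan X (b # bs)"
    if "v \<in> fspan X bs" for c d v
  proof -
    have "vscale X d (vadd X (vscale X c b) v) = vadd X (vscale X (d * c) b) (vscale X d v)"
      using that b WX by (simp add: scale_add_right scale_scale closed)
    then show ?thesis using mem W(4)[OF that] by metis
  qed
  moreover have "vzero X \<in> fspan X (b # bs)"
    using mem[OF W(2), of 0] b by (simp add: scale_zero_left closed add_zero del: fspan.simps)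
  moreover have "fspan X (b # bs) \<subseteq> vcarrier X"
    using b WX by (auto simp: closed)
  moreover have "\<exists>c v. x = vadd X (vscale X c b) v \<and> v \<in> fspan X bs" if "x \<in> fspan X (b # bs)" for x
    using that by simp
  ultimately show ?case
    unfolding linear_subspace_def by metis
qed

lemma add_left_cancel:
  assumes "x \<in> vcarrier X" "y \<in> vcarrier X" "z \<in> vcarrier X" "vadd X x y = vadd X x z"
  shows "y = z"
  by (metis assms add_sub_cancel)

text \<open>A basis of \<open>W\<close> is extended by \<open>v\<close>. If two representations had
  different coefficients of \<open>v\<close>, their difference could be solved for \<open>v\<close>,
  which would put \<open>v\<close> into \<open>W\<close>.\<close>

lemma has_dim_insert:
  assumes V: "linear_subspace V X" and W: "linear_subspace W X" "W \<subseteq> V" "has_dim X W n"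
    and v: "v \<in> V" "v \<notin> W"
    and split: "\<And>x. x \<in> V \<Longrightarrow> \<exists>a. \<exists>y\<in>W. x = vadd X (vscale X a v) y"
  shows "has_dim X V (Suc n)"
proof -
  have VX: "x \<in> vcarrier X" if "x \<in> V" for x using V that by (auto simp: linear_subspace_def)
  have WX: "x \<in> vcarrier X" if "x \<in> W" for x using W VX that by auto
  have Wc: "vadd X x y \<in> W" "vscale X c x \<in> W" if "x \<in> W" "y \<in> W" for x y c
    using W that by (auto simp: linear_subspace_def)
  obtain ds where ds: "length ds = n" "set ds \<subseteq> W"
    and ex1: "\<And>w. w \<in> W \<Longrightarrow> \<exists>!cs. length cs = n \<and> lincomb X cs ds = w"
    using W(3) by (auto simp: has_dim_def)
  have lW: "lincomb X cs ds \<in> W" if "length cs = n" for cs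
    using lincomb_in_linear_subspace W(1) ds that by blast
  have uniq: "a = a' \<and> y = y'" if eq: "vadd X (vscale X a v) y = vadd X (vscale X a' v) y'"
    and y: "y \<in> W" "y' \<in> W" for a a' y y'
  proof -
    have c: "v \<in> vcarrier X" "y \<in> vcarrier X" "y' \<in> vcarrier X" using v y VX WX by auto
    have "a = a'"
    proof (rule ccontr)
      assume "a \<noteq> a'"
      have "vsub X (vadd X (vscale X a v) y) (vscale X a' v) = vadd X (vscale X (a - a') v) y"
        using c scale_add_left[of v a "- a'"] by (simp add: scale_scale add_ac closed)
      then have "vadd X (vscale X (a - a') v) y = y'"
        using c by (simp add: eq add_sub_cancel closed)
      moreover have "vsub X (vadd X y (vscale X (a - a') v)) y = vscale X (a - a') v"
        using c by (intro add_sub_cancel) (auto simp: closed)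
      ultimately have "vscale X (a - a') v = vsub X y' y"
        using c by (simp add: add_commute closed)
      then have "vscale X (inverse (a - a') * (a - a')) v = vscale X (inverse (a - a')) (vsub X y' y)"
        using c by (metis scale_scale)
      then have "v = vscale X (inverse (a - a')) (vsub X y' y)"
        using \<open>a \<noteq> a'\<close> c by (simp add: scale_one)
      then show False using v y Wc by metis
    qed
    then show ?thesis using eq c add_left_cancel[of "vscale X a v" y y'] by (simp add: closed)
  qed
  have "\<exists>!cs. length cs = Suc n \<and> lincomb X cs (v # ds) = x" if "x \<in> V" for x
  proof -
    obtain a y where y: "y \<in> W" "x = vadd X (vscale X a v) y" using split \<open>x \<in> V\<close> by blast
    obtain cs where cs: "length cs = n" "lincomb X cs ds = y" using ex1[OF y(1)] by blast
    show ?thesis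
    proof (rule ex1I[of _ "a # cs"])
      show "length (a # cs) = Suc n \<and> lincomb X (a # cs) (v # ds) = x"
        using cs y by (simp add: lincomb_simps)
      fix es assume es: "length es = Suc n \<and> lincomb X es (v # ds) = x"
      then obtain e fs where fs: "es = e # fs" "length fs = n" by (metis length_Suc_conv)
      then have "e = a \<and> lincomb X fs ds = y"
        using es y lW[of fs] by (intro uniq) (auto simp: lincomb_simps)
      then show "es = a # cs" using ex1[OF y(1)] cs fs by blast
    qed
  qed
  moreover have "length (v # ds) = Suc n" "set (v # ds) \<subseteq> V" using ds W(2) v by auto
  ultimately show ?thesis using V unfolding has_dim_def by blast
qed

text \<open>Induction on the generators: the intersection of \<open>V\<close> with the span
  \<open>?F\<close> of the remaining generators has a basis by induction, and \<open>V\<close>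
  either lies in \<open>?F\<close> or needs exactly one further basis vector.\<close>

lemma has_dim_of_fspan:
  assumes "linear_subspace V X" "set bs \<subseteq> vcarrier X" "V \<subseteq> fspan X bs"
  shows "\<exists>n. has_dim X V n"
  using assms
proof (induction bs arbitrary: V)
  case Nil
  then have "V = {vzero X}" by (auto simp: linear_subspace_def)
  then have "has_dim X V 0"
    using Nil(1) unfolding has_dim_def
    by (intro conjI exI[of _ "[]"]) (auto simp: lincomb_simps)
  then show ?case by blast
next
  case (Cons b bs)
  let ?F = "fspan X bs"
  have b: "b \<in> vcarrier X" using Cons.prems by simp
  have F: "linear_subspace ?F X" using linear_subspace_fspan Cons.prems by simp
  then have FX: "w \<in> vcarrier X" if "w \<in> ?F" for w using that by (auto simp: linear_subspace_def)
  have VF: "linear_subspace (V \<inter> ?F) X" using linear_subspace_Int Cons.prems F by blast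
  obtain n where n: "has_dim X (V \<inter> ?F) n"
    using Cons.IH[OF VF] Cons.prems by auto
  show ?case
  proof (cases "V \<subseteq> ?F")
    case True
    then show ?thesis using n by (metis inf.absorb1)
  next
    case False
    then obtain v where v: "v \<in> V" "v \<notin> ?F" by blast
    then obtain c w where w: "w \<in> ?F" "v = vadd X (vscale X c b) w" using Cons.prems(3) by auto
    have "c \<noteq> 0"
    proof
      assume "c = 0"
      then have "v = w" using w b FX by (simp add: scale_zero_left add_zero)
      then show False using v w by simp
    qed
    have "has_dim X V (Suc n)"
    proof (rule has_dim_insert[OF Cons.prems(1) VF _ n v(1)])
      fix x assume "x \<in> V"
      then obtain c' w' where w': "w' \<in> ?F" "x = vadd X (vscale X c' b) w'" using Cons.prems(3) by auto
      \<comment> \<open>The coefficient \<open>c' / c\<close> makes the multiples of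
        \<open>b\<close> in \<open>x\<close> and in the multiple of \<open>v\<close> cancel, which
        leaves a remainder in \<open>?F\<close>.\<close>
      let ?y = "vsub X x (vscale X (c' / c) v)"
      have cc: "w \<in> vcarrier X" "w' \<in> vcarrier X" "v \<in> vcarrier X" "x \<in> vcarrier X"
        using w w' b FX by (auto simp: closed)
      have "vscale X (c' / c) v = vadd X (vscale X c' b) (vscale X (c' / c) w)"
        using w b cc \<open>c \<noteq> 0\<close> by (simp add: scale_add_right scale_scale closed)
      then have "?y = vadd X (vsub X (vscale X c' b) (vscale X c' b)) (vsub X w' (vscale X (c' / c) w))"
        using w'(2) b cc sub_add_add by (simp add: closed)
      then have "?y = vsub X w' (vscale X (c' / c) w)"
        using b cc by (simp add: add_neg add_zero closed)
      then have "?y \<in> ?F" using F w w' by (simp add: linear_subspace_def)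
      moreover have "?y \<in> V" using Cons.prems(1) v \<open>x \<in> V\<close> by (simp add: linear_subspace_def)
      moreover have "x = vadd X (vscale X (c' / c) v) ?y"
        using cc by (simp add: sub_add_cancel closed)
      ultimately show "\<exists>a. \<exists>y\<in>V \<inter> ?F. x = vadd X (vscale X a v) y" by blast
    qed (use v in auto)
    then show ?thesis by blast
  qed
qed

lemma fspan_lincomb: "fspan X bs = {lincomb X cs bs |cs. length cs = length bs}"
proof (induction bs)
  case (Cons b bs)
  show ?case
  proof (intro set_eqI iffI)
    fix x assume "x \<in> fspan X (b # bs)"
    then obtain c cs where "x = lincomb X (c # cs) (b # bs)" "length (c # cs) = length (b # bs)"
      using Cons by (auto simp: lincomb_simps)
    then show "x \<in> {lincomb X cs (b # bs) |cs. length cs = length (b # bs)}" by blast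
  next
    fix x assume "x \<in> {lincomb X cs (b # bs) |cs. length cs = length (b # bs)}"
    then obtain c cs where "x = lincomb X (c # cs) (b # bs)" "length cs = length bs"
      by (auto simp: length_Suc_conv)
    then show "x \<in> fspan X (b # bs)"
      using Cons by (simp add: lincomb_simps) blast
  qed
qed (auto simp: lincomb_simps)

lemma fspan_append:
  assumes "set as \<subseteq> vcarrier X" "set bs \<subseteq> vcarrier X" "v \<in> fspan X as" "w \<in> fspan X bs"
  shows "vadd X v w \<in> fspan X (as @ bs)"
  using assms
proof (induction as arbitrary: v)
  case Nil
  then show ?case using linear_subspace_fspan[of bs] by (auto simp: linear_subspace_def add_zero)
next
  case (Cons a as)
  then obtain c v' where v: "v' \<in> fspan X as" "v = vadd X (vscale X c a) v'" by auto
  have "v' \<in> vcarrier X" "w \<in> vcarrier X"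
    using v Cons.prems linear_subspace_fspan[of as] linear_subspace_fspan[of bs]
    by (auto simp: linear_subspace_def)
  then have "vadd X v w = vadd X (vscale X c a) (vadd X v' w)"
    using v Cons.prems by (simp add: add_assoc closed)
  moreover have "vadd X v' w \<in> fspan X (as @ bs)" using Cons v by auto
  ultimately show ?case by auto
qed

end

section \<open>Finite-rank operators and their linear structure\<close>

context normed_pair
begin

lemma linear_subspace_range:
  assumes T: "T \<in> operators X Y"
  shows "linear_subspace (T ` vcarrier X) Y"
proof -
  have "vzero Y \<in> T ` vcarrier X" using X.zero_closed by (force simp: op_zero[OF T, symmetric])
  moreover have "vadd Y (T x) (T y) \<in> T ` vcarrier X" if "x \<in> vcarrier X" "y \<in> vcarrier X" for x y
    using X.add_closed[OF that] by (force simp: operatorsD(3)[OF T that, symmetric])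
  moreover have "vscale Y c (T x) \<in> T ` vcarrier X" if "x \<in> vcarrier X" for c x
    using X.scale_closed[OF that] by (force simp: operatorsD(4)[OF T that, symmetric])
  ultimately show ?thesis using operatorsD(1)[OF T] by (auto simp: linear_subspace_def)
qed

text \<open>Trades the basis hidden in \<open>has_rank\<close> for a list whose span contains the
  range; it may be redundant and may contain vectors outside the range. In this form sums and
  multiples are easy to treat.\<close>

lemma finite_rank_iff:
  "T \<in> finite_rank_operators X Y \<longleftrightarrow>
    T \<in> operators X Y \<and> (\<exists>bs. set bs \<subseteq> vcarrier Y \<and> T ` vcarrier X \<subseteq> fspan Y bs)"
proof
  assume "T \<in> finite_rank_operators X Y"
  then obtain r where T: "T \<in> operators X Y" and "has_dim Y (T ` vcarrier X) r"
    unfolding finite_rank_operators_def has_rank_def by blast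
  then obtain bs where bs: "set bs \<subseteq> T ` vcarrier X"
    and ex1: "\<forall>v\<in>T ` vcarrier X. \<exists>!cs. length cs = length bs \<and> lincomb Y cs bs = v"
    unfolding has_dim_def by blast
  have "T ` vcarrier X \<subseteq> fspan Y bs"
  proof
    fix v assume "v \<in> T ` vcarrier X"
    from bspec[OF ex1 this, THEN ex1_implies_ex] show "v \<in> fspan Y bs"
      unfolding Y.fspan_lincomb by auto
  qed
  moreover have "set bs \<subseteq> vcarrier Y" using bs operatorsD(1)[OF T] by auto
  ultimately show "T \<in> operators X Y \<and> (\<exists>bs. set bs \<subseteq> vcarrier Y \<and> T ` vcarrier X \<subseteq> fspan Y bs)"
    using T by blast
next
  assume "T \<in> operators X Y \<and> (\<exists>bs. set bs \<subseteq> vcarrier Y \<and> T ` vcarrier X \<subseteq> fspan Y bs)"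
  then obtain bs where T: "T \<in> operators X Y" and "set bs \<subseteq> vcarrier Y"
    "T ` vcarrier X \<subseteq> fspan Y bs" by blast
  then have "\<exists>r. has_dim Y (T ` vcarrier X) r"
    using Y.has_dim_of_fspan linear_subspace_range by blast
  then show "T \<in> finite_rank_operators X Y"
    using T by (simp add: finite_rank_operators_def has_rank_def)
qed

lemma finite_rank_zero: "(\<lambda>x\<in>vcarrier X. vzero Y) \<in> finite_rank_operators X Y"
proof -
  have "(\<lambda>x\<in>vcarrier X. vzero Y) ` vcarrier X \<subseteq> fspan Y []" by auto
  then show ?thesis unfolding finite_rank_iff using operators_zero
    by (metis empty_subsetI list.set(1))
qed

lemma finite_rank_add:
  assumes "S \<in> finite_rank_operators X Y" "T \<in> finite_rank_operators X Y"
  shows "vadd (operator_space X Y) S T \<in> finite_rank_operators X Y"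
proof -
  obtain as bs where S: "S \<in> operators X Y" "set as \<subseteq> vcarrier Y" "S ` vcarrier X \<subseteq> fspan Y as"
    and T: "T \<in> operators X Y" "set bs \<subseteq> vcarrier Y" "T ` vcarrier X \<subseteq> fspan Y bs"
    using assms unfolding finite_rank_iff by blast
  have "vadd (operator_space X Y) S T ` vcarrier X \<subseteq> fspan Y (as @ bs)"
    using S T by (auto simp: operator_space_simps intro!: Y.fspan_append)
  moreover have "vadd (operator_space X Y) S T \<in> operators X Y"
    using L.add_closed S T by (simp add: operator_space_simps)
  moreover have "set (as @ bs) \<subseteq> vcarrier Y" using S T by simp
  ultimately show ?thesis unfolding finite_rank_iff by blast
qed

lemma finite_rank_scale:
  assumes "T \<in> finite_rank_operators X Y"
  shows "vscale (operator_space X Y) c T \<in> finite_rank_operators X Y"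
proof -
  obtain bs where T: "T \<in> operators X Y" "set bs \<subseteq> vcarrier Y" "T ` vcarrier X \<subseteq> fspan Y bs"
    using assms unfolding finite_rank_iff by blast
  have "vscale (operator_space X Y) c T ` vcarrier X \<subseteq> fspan Y bs"
    using T(3) Y.linear_subspace_fspan[OF T(2)]
    by (auto simp: operator_space_simps linear_subspace_def)
  moreover have "vscale (operator_space X Y) c T \<in> operators X Y"
    using L.scale_closed T by (simp add: operator_space_simps)
  ultimately show ?thesis unfolding finite_rank_iff using T(2) by blast
qed

text \<open>Serves to show that an operator factoring through \<open>ell2 n\<close> has finite rank:
  images of spanning vectors span the image.\<close>

lemma range_subset_fspan:
  assumes T: "T \<in> operators X Y" and bs: "set bs \<subseteq> vcarrier X" and x: "x \<in> fspan X bs"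
  shows "T x \<in> fspan Y (map T bs)"
  using bs x
proof (induction bs arbitrary: x)
  case Nil
  then show ?case by (simp add: op_zero[OF T])
next
  case (Cons b bs)
  then obtain c w where w: "w \<in> fspan X bs" "x = vadd X (vscale X c b) w" by auto
  have "w \<in> vcarrier X"
    using w Cons.prems X.linear_subspace_fspan[of bs] by (auto simp: linear_subspace_def)
  then have "T x = vadd Y (vscale Y c (T b)) (T w)"
    using w Cons.prems by (simp add: operatorsD[OF T] X.closed)
  then show ?case using Cons w by auto
qed

end

section \<open>Complemented copies of Hilbert spaces\<close>

lemma
  assumes "normed_space X" "normed_space Y" "normed_space Z"
    and S: "S \<in> operators X Y" and T: "T \<in> operators Y Z"
  shows operators_compose: "compose (vcarrier X) T S \<in> operators X Z"
    and opnorm_compose: "opnorm X Z (compose (vcarrier X) T S) \<le> opnorm Y Z T * opnorm X Y S"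
proof -
  interpret X: normed_space X by fact
  interpret Y: normed_space Y by fact
  interpret Z: normed_space Z by fact
  interpret XY: normed_pair X Y ..
  interpret YZ: normed_pair Y Z ..
  interpret XZ: normed_pair X Z ..
  have bound: "vnorm Z (compose (vcarrier X) T S x) \<le> opnorm Y Z T * opnorm X Y S * vnorm X x"
    if x: "x \<in> vcarrier X" for x
  proof -
    have "vnorm Z (T (S x)) \<le> opnorm Y Z T * vnorm Y (S x)"
      using YZ.opnorm_bound[OF T] operatorsD(1)[OF S x] by blast
    also have "\<dots> \<le> opnorm Y Z T * (opnorm X Y S * vnorm X x)"
      using XY.opnorm_bound[OF S x] YZ.opnorm_nonneg[OF T] by (rule mult_left_mono)
    finally show ?thesis using x by (simp add: compose_def mult.assoc)
  qed
  show "compose (vcarrier X) T S \<in> operators X Z"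
    by (rule operatorsI[where K = "opnorm Y Z T * opnorm X Y S"])
      (use bound in \<open>auto simp: compose_def operatorsD[OF S] operatorsD[OF T] X.closed\<close>)
  show "opnorm X Z (compose (vcarrier X) T S) \<le> opnorm Y Z T * opnorm X Y S"
    using XY.opnorm_nonneg[OF S] YZ.opnorm_nonneg[OF T] bound by (intro XZ.opnorm_le) auto
qed

section \<open>Finite-dimensional Hilbert spaces\<close>

lemma normed_space_ell2: "normed_space (ell2 n)"
proof -
  have "L2_set (\<lambda>i. norm (x i + y i)) {..<n}
      \<le> L2_set (\<lambda>i. norm (x i)) {..<n} + L2_set (\<lambda>i. norm (y i)) {..<n}" for x y :: "nat \<Rightarrow> 'a"
  proof -
    have "L2_set (\<lambda>i. norm (x i + y i)) {..<n} \<le> L2_set (\<lambda>i. norm (x i) + norm (y i)) {..<n}"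
      by (rule L2_set_mono) (auto simp: norm_triangle_ineq)
    also have "\<dots> \<le> L2_set (\<lambda>i. norm (x i)) {..<n} + L2_set (\<lambda>i. norm (y i)) {..<n}"
      by (rule L2_set_triangle_ineq)
    finally show ?thesis .
  qed
  moreover have "L2_set (\<lambda>i. norm (x i)) {..<n} = 0 \<longleftrightarrow> x = (\<lambda>i. 0)" if "\<forall>i\<ge>n. x i = 0"
    for x :: "nat \<Rightarrow> 'a"
    using that by (auto simp: L2_set_eq_0_iff fun_eq_iff) (meson lessThan_iff not_less)
  ultimately show ?thesis
    unfolding ell2_def
    by unfold_locales
      (auto simp: fun_eq_iff algebra_simps norm_mult L2_set_right_distrib)
qed

text \<open>The dimension \<open>m\<close> varies in the induction while the ambient
  \<open>ell2 n\<close> stays fixed; the vector operations of \<open>ell2\<close> do not depend on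
  the dimension. The list is reversed so that the newest unit vector \<open>e m\<close> comes first,
  as the recursion of \<open>fspan\<close> expects.\<close>

lemma ell2_subset_fspan:
  fixes n :: nat
  defines "e \<equiv> \<lambda>j i. if i = j then 1 else (0 :: 'k::real_normed_field)"
  shows "vcarrier (ell2 m) \<subseteq> fspan (ell2 n :: ('k, _) nspace) (map e (rev [0..<m]))"
proof (induction m)
  case 0
  then show ?case by (auto simp: ell2_def)
next
  case (Suc m)
  show ?case
  proof
    fix x :: "nat \<Rightarrow> 'k" assume x: "x \<in> vcarrier (ell2 (Suc m))"
    then have "x(m := 0) \<in> vcarrier (ell2 m)"
      by (auto simp: ell2_def)
    then have "x(m := 0) \<in> fspan (ell2 n) (map e (rev [0..<m]))" using Suc by blast
    moreover have "x = vadd (ell2 n) (vscale (ell2 n) (x m) (e m)) (x(m := 0))"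
      by (auto simp: ell2_def e_def)
    ultimately show "x \<in> fspan (ell2 n) (map e (rev [0..<Suc m]))" by auto
  qed
qed

text \<open>\<open>J\<close> is the isomorphism \<open>v\<close> followed by the inclusion of
  \<open>E\<close>, and \<open>Q\<close> is \<open>u\<close> after the projection \<open>P\<close>.
  Since \<open>P\<close> fixes its range \<open>E\<close>, \<open>Q\<close> undoes \<open>J\<close>.
  The composition \<open>Q\<close> accounts for the constant \<open>C * C\<close>.\<close>

lemma uniformly_complemented_ell2_factor:
  assumes "normed_space Z" and "uniformly_complemented_ell2 Z"
  obtains K where "K \<ge> 1" and "\<And>n. n \<ge> 1 \<Longrightarrow>
    \<exists>J\<in>operators (ell2 n) Z. \<exists>Q\<in>operators Z (ell2 n).
      (\<forall>y\<in>vcarrier (ell2 n). Q (J y) = y) \<and> opnorm (ell2 n) Z J \<le> K \<and> opnorm Z (ell2 n) Q \<le> K"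
proof -
  interpret Z: normed_space Z by fact
  obtain C where C: "C \<ge> 1" and data: "\<And>n. n \<ge> 1 \<Longrightarrow> \<exists>E u v P.
        linear_subspace E Z \<and>
        u \<in> operators (subspace_of Z E) (ell2 n) \<and>
        v \<in> operators (ell2 n) (subspace_of Z E) \<and>
        compose E v u = id_op (subspace_of Z E) \<and>
        compose (vcarrier (ell2 n)) u v = id_op (ell2 n) \<and>
        max (opnorm (subspace_of Z E) (ell2 n) u) (opnorm (ell2 n) (subspace_of Z E) v) \<le> C \<and>
        P \<in> operators Z Z \<and> compose (vcarrier Z) P P = P \<and>
        P ` vcarrier Z = E \<and> opnorm Z Z P \<le> C"
    using assms(2) unfolding uniformly_complemented_ell2_def by meson
  have "C \<le> C * C" using C mult_left_mono[of 1 C C] by simp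
  show ?thesis
  proof (rule that[of "C * C"])
    show "1 \<le> C * C" using C \<open>C \<le> C * C\<close> by linarith
    fix n :: nat assume "n \<ge> 1"
    then obtain E u v P where E: "linear_subspace E Z"
      and u: "u \<in> operators (subspace_of Z E) (ell2 n)"
      and v: "v \<in> operators (ell2 n) (subspace_of Z E)"
      and uv: "compose (vcarrier (ell2 n)) u v = id_op (ell2 n)"
      and un: "opnorm (subspace_of Z E) (ell2 n) u \<le> C"
      and vn: "opnorm (ell2 n) (subspace_of Z E) v \<le> C"
      and P: "P \<in> operators Z Z" and PP: "compose (vcarrier Z) P P = P"
      and PE: "P ` vcarrier Z = E" and Pn: "opnorm Z Z P \<le> C"
      using data[OF \<open>n \<ge> 1\<close>] by auto
    interpret E: normed_space "subspace_of Z E" using Z.subspace_normed[OF E] .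
    interpret l: normed_space "ell2 n :: ('a, _) nspace" by (rule normed_space_ell2)
    interpret lE: normed_pair "ell2 n" "subspace_of Z E" ..
    interpret lZ: normed_pair "ell2 n" Z ..
    interpret ZZ: normed_pair Z Z ..
    interpret ZE: normed_pair Z "subspace_of Z E" ..
    have EZ: "x \<in> vcarrier Z" if "x \<in> E" for x using E that by (auto simp: linear_subspace_def)
    have vE: "v y \<in> E" if "y \<in> vcarrier (ell2 n)" for y using operatorsD(1)[OF v that] by simp
    have Pb: "vnorm Z (P x) \<le> C * vnorm Z x" if "x \<in> vcarrier Z" for x
      using ZZ.opnorm_bound_le[OF P that Pn] .
    have vb: "vnorm Z (v y) \<le> C * vnorm (ell2 n) y" if "y \<in> vcarrier (ell2 n)" for y
      using lE.opnorm_bound_le[OF v that vn] by simp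
    have J: "v \<in> operators (ell2 n) Z"
      by (rule operatorsI[where K = C]) (use vb vE EZ operatorsD[OF v] in auto)
    have Jn: "opnorm (ell2 n) Z v \<le> C * C"
      using lZ.opnorm_le[of C v, OF _ vb] C \<open>C \<le> C * C\<close> by linarith
    have P': "P \<in> operators Z (subspace_of Z E)"
      by (rule operatorsI[where K = C]) (use Pb PE operatorsD[OF P] in auto)
    have Pn': "opnorm Z (subspace_of Z E) P \<le> C"
      using Pb C by (intro ZE.opnorm_le) auto
    let ?Q = "compose (vcarrier Z) u P"
    have Q: "?Q \<in> operators Z (ell2 n)"
      using operators_compose[OF assms(1) E.normed_space_axioms l.normed_space_axioms P' u] .
    have "opnorm Z (ell2 n) ?Q
        \<le> opnorm (subspace_of Z E) (ell2 n) u * opnorm Z (subspace_of Z E) P"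
      using opnorm_compose[OF assms(1) E.normed_space_axioms l.normed_space_axioms P' u] .
    also have "\<dots> \<le> C * C"
      using un Pn' C ZE.opnorm_nonneg[OF P'] by (intro mult_mono) auto
    finally have Qn: "opnorm Z (ell2 n) ?Q \<le> C * C" .
    have "?Q (v y) = y" if y: "y \<in> vcarrier (ell2 n)" for y
    proof -
      obtain z where z: "z \<in> vcarrier Z" "v y = P z" using vE[OF y] PE by auto
      then have "P (v y) = v y" using fun_cong[OF PP, of z] by (simp add: compose_def)
      moreover have "u (v y) = y" using fun_cong[OF uv, of y] y by (simp add: compose_def)
      ultimately show ?thesis using EZ[OF vE[OF y]] by (simp add: compose_def)
    qed
    then show "\<exists>J\<in>operators (ell2 n) Z. \<exists>Q\<in>operators Z (ell2 n).
      (\<forall>y\<in>vcarrier (ell2 n). Q (J y) = y) \<and> opnorm (ell2 n) Z J \<le> C * C \<and> opnorm Z (ell2 n) Q \<le> C * C"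
      using J Q Jn Qn by blast
  qed
qed

text \<open>
  The range of an embedding \<open>J\<close> of \<open>L\<close> into \<open>X\<close> with left inverse \<open>Q\<close>, given the norm of \<open>L\<close>: an
  isometric copy of \<open>L\<close> whose elements have the same type as those of \<open>X\<close>, as \<open>s_ell2\<close> requires.
\<close>

definition renormed_range ::
  "('k::real_normed_field, 'a) nspace \<Rightarrow> ('k, 'b) nspace \<Rightarrow> ('b \<Rightarrow> 'a) \<Rightarrow> ('a \<Rightarrow> 'b) \<Rightarrow> ('k, 'a) nspace" where
  "renormed_range X L J Q = X\<lparr>vcarrier := J ` vcarrier L, vnorm := (\<lambda>x. vnorm L (Q x))\<rparr>"

locale retraction = X: banach_space X + L: normed_space L
  for X :: "('k::real_normed_field, 'a) nspace" and L :: "('k, 'b) nspace" +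
  fixes J Q
  assumes J: "J \<in> operators L X" and Q: "Q \<in> operators X L"
    and QJ: "\<And>y. y \<in> vcarrier L \<Longrightarrow> Q (J y) = y"
begin

sublocale LX: normed_pair L X ..
sublocale XL: normed_pair X L ..

abbreviation "H \<equiv> renormed_range X L J Q"

lemma H_simps: "vcarrier H = J ` vcarrier L" "vzero H = vzero X" "vadd H = vadd X"
  "vscale H = vscale X" "vnorm H x = vnorm L (Q x)"
  by (simp_all add: renormed_range_def)

lemma H_subset: "x \<in> vcarrier H \<Longrightarrow> x \<in> vcarrier X"
  using operatorsD(1)[OF J] by (auto simp: H_simps)

lemma JQ: "x \<in> vcarrier H \<Longrightarrow> J (Q x) = x"
  by (auto simp: H_simps QJ)

lemma J_H: "y \<in> vcarrier L \<Longrightarrow> J y \<in> vcarrier H"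
  by (simp add: H_simps)

lemma Q_L: "x \<in> vcarrier X \<Longrightarrow> Q x \<in> vcarrier L"
  by (rule operatorsD(1)[OF Q])

text \<open>Definiteness of the new norm: \<open>J\<close> undoes \<open>Q\<close> on the range, so
  \<open>Q\<close> is injective there.\<close>

lemma Q_zero_iff: "x \<in> vcarrier H \<Longrightarrow> Q x = vzero L \<longleftrightarrow> x = vzero X"
  using LX.op_zero[OF J] XL.op_zero[OF Q] JQ by metis

lemma normed_space_H: "normed_space H"
proof -
  have E: "linear_subspace (J ` vcarrier L) X" using LX.linear_subspace_range[OF J] .
  interpret E: normed_space "subspace_of X (J ` vcarrier L)" using X.subspace_normed[OF E] .
  have HX: "x \<in> vcarrier X" if "x \<in> J ` vcarrier L" for x using H_subset that by (simp add: H_simps)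
  have Q0: "x \<in> J ` vcarrier L \<Longrightarrow> Q x = vzero L \<longleftrightarrow> x = vzero X" for x
    using Q_zero_iff by (simp add: H_simps)
  show ?thesis
    unfolding renormed_range_def
    by unfold_locales
      (use E.zero_closed E.add_closed E.scale_closed E.add_assoc E.add_commute E.add_zero E.add_neg
          E.scale_one E.scale_scale E.scale_add_left E.scale_add_right HX Q0 in
        \<open>simp_all add: L.norm_nonneg L.norm_eq_zero L.norm_scale L.norm_triangle operatorsD[OF Q]\<close>)
qed

sublocale H: normed_space H by (rule normed_space_H)
sublocale HX: normed_pair H X ..

lemma norm_X_le: "x \<in> vcarrier H \<Longrightarrow> vnorm X x \<le> opnorm L X J * vnorm H x"
  using LX.opnorm_bound[OF J Q_L[OF H_subset]] by (simp add: JQ H_simps(5))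

lemma inclusion: "id_op H \<in> operators H X"
  by (rule operatorsI[where K = "opnorm L X J"])
    (use norm_X_le H_subset H.closed in \<open>auto simp: H_simps(3,4)\<close>)

lemma opnorm_inclusion: "opnorm H X (id_op H) \<le> opnorm L X J"
  using norm_X_le LX.opnorm_nonneg[OF J] by (intro HX.opnorm_le) auto

lemma J_operator_H: "J \<in> operators L H"
  by (rule operatorsI[where K = 1]) (auto simp: J_H QJ H_simps(3-5) operatorsD[OF J])

lemma opnorm_J_H: "opnorm L H J \<le> 1"
proof -
  interpret LH: normed_pair L H ..
  show ?thesis by (rule LH.opnorm_le) (auto simp: QJ H_simps(5))
qed

lemma isometric_H: "isometric H L"
  unfolding isometric_def
proof (intro bexI conjI ballI)
  let ?u = "restrict Q (vcarrier H)"
  show "?u \<in> operators H L"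
    by (rule operatorsI[where K = 1])
      (use H.closed in \<open>auto simp: H_subset operatorsD[OF Q] H_simps(3-5)\<close>)
  show "bij_betw ?u (vcarrier H) (vcarrier L)"
    by (rule bij_betw_byWitness[where f' = J])
      (auto simp: JQ QJ J_H Q_L H_subset)
  show "vnorm L (?u x) = vnorm H x" if "x \<in> vcarrier H" for x
    using that by (simp add: H_simps(5))
qed

text \<open>The axioms for s-numbers speak of Banach spaces only, so completeness of
  \<open>H\<close> is required before \<open>s_ell2\<close> applies. On \<open>H\<close> the norm of
  \<open>X\<close> is bounded by a multiple of the new one, so Cauchy sequences of \<open>H\<close>
  are Cauchy in \<open>X\<close>, and boundedness of \<open>Q\<close> carries convergence
  back.\<close>

lemma banach_space_H: "banach_space H"
  unfolding H.banach_space_iff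
proof (intro allI impI)
  fix \<sigma> assume "vcauchy H \<sigma>"
  then have \<sigma>: "\<sigma> n \<in> vcarrier H"
    and Cauchy: "e > 0 \<Longrightarrow> \<exists>N. \<forall>m\<ge>N. \<forall>n\<ge>N. vnorm H (vsub H (\<sigma> m) (\<sigma> n)) < e" for n e
    by (auto simp: vcauchy_def)
  have \<sigma>X: "\<sigma> n \<in> vcarrier X" for n using \<sigma> H_subset by blast
  \<comment> \<open>Adding 1 makes the factor positive, since the norm of \<open>J\<close> may
    vanish.\<close>
  let ?K = "opnorm L X J + 1"
  have K: "?K > 0" using LX.opnorm_nonneg[OF J] by simp
  have "vcauchy X \<sigma>"
    unfolding vcauchy_def
  proof (intro conjI allI impI \<sigma>X)
    fix e :: real assume "e > 0"
    then obtain N where N: "\<And>m n. m \<ge> N \<Longrightarrow> n \<ge> N \<Longrightarrow> vnorm H (vsub H (\<sigma> m) (\<sigma> n)) < e / ?K"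
      using Cauchy[of "e / ?K"] K by auto
    have "vnorm X (vsub X (\<sigma> m) (\<sigma> n)) < e" if "m \<ge> N" "n \<ge> N" for m n
    proof -
      have d: "vsub H (\<sigma> m) (\<sigma> n) \<in> vcarrier H" using \<sigma> by (simp add: H.closed)
      have "vnorm X (vsub X (\<sigma> m) (\<sigma> n)) \<le> opnorm L X J * vnorm H (vsub H (\<sigma> m) (\<sigma> n))"
        using norm_X_le[OF d] by (simp add: H_simps(3,4))
      also have "\<dots> \<le> ?K * vnorm H (vsub H (\<sigma> m) (\<sigma> n))"
        using H.norm_nonneg[OF d] by (simp add: distrib_right)
      also have "\<dots> < e" using N[OF that] K by (simp add: pos_less_divide_eq mult.commute)
      finally show ?thesis .
    qed
    then show "\<exists>N. \<forall>m\<ge>N. \<forall>n\<ge>N. vnorm X (vsub X (\<sigma> m) (\<sigma> n)) < e" by blast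
  qed
  then obtain x where x: "vlim X \<sigma> x" using X.banach_space_axioms X.banach_space_iff by blast
  then have xX: "x \<in> vcarrier X" by (simp add: vlim_def)
  \<comment> \<open>The limit in \<open>X\<close> is mapped back into \<open>H\<close>.
    \<open>Q\<close> takes the same value at \<open>x\<close> and \<open>?y\<close>, and the norm of
    \<open>H\<close> sees only values of \<open>Q\<close>.\<close>
  let ?y = "J (Q x)"
  have "vlim H \<sigma> ?y"
  proof (rule H.vlim_bound[OF \<sigma>])
    show "?y \<in> vcarrier H" using xX by (simp add: J_H Q_L)
    show "(\<lambda>n. opnorm X L Q * vnorm X (vsub X (\<sigma> n) x)) \<longlonglongrightarrow> 0"
      using x by (auto simp: vlim_def intro: tendsto_mult_right_zero)
    show "vnorm H (vsub H (\<sigma> n) ?y) \<le> opnorm X L Q * vnorm X (vsub X (\<sigma> n) x)" for n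
    proof -
      have "vnorm H (vsub H (\<sigma> n) ?y) = vnorm L (Q (vsub X (\<sigma> n) ?y))" by (simp add: H_simps(3-5))
      also have "Q (vsub X (\<sigma> n) ?y) = Q (vsub X (\<sigma> n) x)"
        using \<sigma>X xX operatorsD(1)[OF J] by (simp add: operatorsD[OF Q] X.closed Q_L QJ)
      also have "vnorm L \<dots> \<le> opnorm X L Q * vnorm X (vsub X (\<sigma> n) x)"
        using \<sigma>X xX by (intro XL.opnorm_bound[OF Q]) (simp add: X.closed)
      finally show ?thesis .
    qed
  qed
  then show "\<exists>x. vlim H \<sigma> x" by blast
qed

end

section \<open>s-numbers\<close>

text \<open>As a closed part of a complete space, \<open>S\<close> is completely metrizable. If
  every \<open>F n\<close> had empty interior relative to \<open>S\<close>, the Baire theorem would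
  make the interior of the union empty, whereas the union covers the nonempty
  \<open>S\<close>.\<close>

lemma (in Metric_space) Baire_category_closedin:
  assumes "mcomplete" and M': "closedin mtopology S" "S \<noteq> {}"
    and F: "\<And>n::nat. closedin mtopology (F n)" and cover: "S \<subseteq> (\<Union>n. F n)"
  obtains n x r where "x \<in> S" "r > 0" "S \<inter> mball x r \<subseteq> F n"
proof -
  let ?T = "subtopology mtopology S"
  have S: "S \<subseteq> M" using M' closedin_metric by blast
  have "completely_metrizable_space ?T"
    using assms(1) M'(1) completely_metrizable_space_closedin completely_metrizable_space_mtopology by blast
  moreover have "closedin ?T (S \<inter> F n)" for n
    using F by (simp add: closedin_subtopology_Int_closed)
  moreover have "(\<Union>n. S \<inter> F n) = topspace ?T"
    using cover S by auto
  moreover have "?T interior_of topspace ?T \<noteq> {}"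
    using S M'(2) interior_of_topspace[of ?T] by (auto simp: inf.absorb2 simp del: interior_of_topspace)
  ultimately obtain n where "?T interior_of (S \<inter> F n) \<noteq> {}"
    using Baire_category_alt[of ?T "range (\<lambda>n. S \<inter> F n)"] by auto
  then obtain U x where "openin ?T U" "x \<in> U" "U \<subseteq> S \<inter> F n"
    by (auto simp: interior_of_def)
  then obtain V where V: "openin mtopology V" "U = V \<inter> S" "x \<in> V" "x \<in> S"
    by (auto simp: openin_subtopology)
  then obtain r where "r > 0" "mball x r \<subseteq> V"
    by (auto simp: openin_mtopology)
  then show ?thesis using that[of x r n] V \<open>U \<subseteq> S \<inter> F n\<close> by blast
qed

section \<open>Consequences of the s-number axioms\<close>

context s_numbers_sequence
begin

text \<open>Scaling \<open>T\<close> is composing it with multiplication by \<open>c\<close> on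
  \<open>Y\<close>, an operator whose first s-number is its norm and hence at most
  \<open>norm c\<close>.\<close>

lemma s_scale:
  assumes "banach_space X" "banach_space Y" and T: "T \<in> operators X Y" and n: "n \<ge> 1"
  shows "s X Y (vscale (operator_space X Y) c T) n \<le> norm c * s X Y T n"
proof -
  interpret X: banach_space X by fact
  interpret Y: banach_space Y by fact
  interpret YY: normed_pair Y Y ..
  let ?M = "\<lambda>y\<in>vcarrier Y. vscale Y c y"
  have M: "?M \<in> operators Y Y"
    by (rule operatorsI[where K = "norm c"])
      (auto simp: Y.closed Y.norm_scale Y.scale_add_right Y.scale_scale mult.commute)
  have "compose (vcarrier X) ?M T = vscale (operator_space X Y) c T"
    by (auto simp: compose_def operator_space_def operatorsD(1)[OF T])
  then have "s X Y (vscale (operator_space X Y) c T) n \<le> s Y Y ?M 1 * s X Y T n"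
    using s_mult[OF assms(1,2,2) T M _ n, of 1] by simp
  also have "s Y Y ?M 1 \<le> norm c"
    unfolding s_norm[OF assms(2,2) M] by (rule YY.opnorm_le) (auto simp: Y.norm_scale)
  finally show ?thesis
    using s_nonneg[OF assms(1-3) n] by (meson order_trans mult_right_mono)
qed

text \<open>Additivity for the sum of \<open>S\<close> and \<open>T - S\<close>, with index 1 for
  the difference, where the s-number is the norm.\<close>

lemma s_perturb:
  assumes "banach_space X" "banach_space Y" and S: "S \<in> operators X Y" and T: "T \<in> operators X Y"
    and n: "n \<ge> 1"
  shows "s X Y T n \<le> s X Y S n + opnorm X Y (vsub (operator_space X Y) T S)"
proof -
  interpret X: banach_space X by fact
  interpret Y: banach_space Y by fact
  interpret XY: normed_pair X Y ..
  let ?D = "vsub (operator_space X Y) T S"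
  have D: "?D \<in> operators X Y" using XY.L.closed S T by (simp add: XY.operator_space_simps)
  have "vadd (operator_space X Y) S ?D = T"
    using XY.L.sub_add_cancel S T by (simp add: XY.operator_space_simps)
  then show ?thesis
    using s_add[OF assms(1,2) D S n, of 1] s_norm[OF assms(1,2) D] by simp
qed

text \<open>These are the sets to which the Baire theorem is applied. A bound on an s-number
  survives norm limits because, by \<open>s_perturb\<close>, the limit exceeds it by at most its
  distance to the approximating operators.\<close>

lemma closedin_s_bounded:
  assumes "banach_space X" "banach_space Y"
  shows "closedin (Metric_space.mtopology (operators X Y) (vdist (operator_space X Y)))
    {T \<in> operators X Y. \<forall>n\<ge>1. s X Y T n \<le> b n}"
proof -
  interpret X: banach_space X by fact
  interpret Y: banach_space Y by fact
  interpret XY: normed_pair X Y ..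
  let ?L = "operator_space X Y" and ?F = "{T \<in> operators X Y. \<forall>n\<ge>1. s X Y T n \<le> b n}"
  have "closedin XY.L.M.mtopology ?F"
    unfolding XY.L.M.metric_closedin_iff_sequentially_closed
  proof (intro conjI allI impI)
    show "?F \<subseteq> vcarrier ?L" by (auto simp: XY.operator_space_simps)
    fix \<sigma> T assume "range \<sigma> \<subseteq> ?F \<and> limitin XY.L.M.mtopology \<sigma> T sequentially"
    then have \<sigma>: "\<And>k. \<sigma> k \<in> ?F" and lim: "limitin XY.L.M.mtopology \<sigma> T sequentially" by auto
    then have "vlim ?L \<sigma> T"
      using XY.L.limitin_iff_vlim[of \<sigma> T] by (auto simp: XY.operator_space_simps)
    then have T: "T \<in> operators X Y" and 0: "(\<lambda>k. opnorm X Y (vsub ?L (\<sigma> k) T)) \<longlonglongrightarrow> 0"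
      by (auto simp: vlim_def XY.operator_space_simps)
    have "s X Y T n \<le> b n" if n: "n \<ge> 1" for n
    proof (rule LIMSEQ_le_const)
      show "(\<lambda>k. b n + opnorm X Y (vsub ?L (\<sigma> k) T)) \<longlonglongrightarrow> b n"
        using tendsto_add[OF tendsto_const[of "b n"] 0] by simp
      have "s X Y T n \<le> b n + opnorm X Y (vsub ?L (\<sigma> k) T)" for k
        using s_perturb[OF assms _ T n, of "\<sigma> k"] \<sigma>[of k] n T XY.L.norm_sub_commute[of "\<sigma> k" T]
        by (force simp: XY.operator_space_simps)
      then show "\<exists>N. \<forall>k\<ge>N. s X Y T n \<le> b n + opnorm X Y (vsub ?L (\<sigma> k) T)" by blast
    qed
    then show "T \<in> ?F" using T by blast
  qed
  then show ?thesis by (simp add: XY.operator_space_simps)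
qed

text \<open>The operator is \<open>J2\<close> after \<open>Q1\<close>. Restricted to the renormed
  range \<open>H\<close> of \<open>J1\<close> and followed by \<open>J1\<close> after
  \<open>Q2\<close>, it becomes the identity of \<open>H\<close>, whose \<open>n\<close>-th s-number
  is 1; multiplicativity turns this into a lower bound with \<open>K\<close> independent of
  \<open>n\<close>.\<close>

lemma exists_finite_rank_s_large:
  assumes BX: "banach_space X" and BY: "banach_space Y"
    and "uniformly_complemented_ell2 X" "uniformly_complemented_ell2 Y"
  obtains K where "K > 0" and "\<And>n. n \<ge> 1 \<Longrightarrow>
    \<exists>A\<in>finite_rank_operators X Y. opnorm X Y A \<le> K \<and> 1 \<le> K * s X Y A n"
proof -
  interpret X: banach_space X by fact
  interpret Y: banach_space Y by fact
  interpret XY: normed_pair X Y ..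
  obtain K1 where K1: "K1 \<ge> 1" and JQ1: "\<And>n. n \<ge> 1 \<Longrightarrow>
    \<exists>J\<in>operators (ell2 n) X. \<exists>Q\<in>operators X (ell2 n).
      (\<forall>y\<in>vcarrier (ell2 n). Q (J y) = y) \<and> opnorm (ell2 n) X J \<le> K1 \<and> opnorm X (ell2 n) Q \<le> K1"
    using uniformly_complemented_ell2_factor[OF X.normed_space_axioms assms(3)] by blast
  obtain K2 where K2: "K2 \<ge> 1" and JQ2: "\<And>n. n \<ge> 1 \<Longrightarrow>
    \<exists>J\<in>operators (ell2 n) Y. \<exists>Q\<in>operators Y (ell2 n).
      (\<forall>y\<in>vcarrier (ell2 n). Q (J y) = y) \<and> opnorm (ell2 n) Y J \<le> K2 \<and> opnorm Y (ell2 n) Q \<le> K2"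
    using uniformly_complemented_ell2_factor[OF Y.normed_space_axioms assms(4)] by blast
  show ?thesis
  proof (rule that[of "K2 * K1"])
    show "0 < K2 * K1" using K1 K2 by simp
    fix n :: nat assume n: "n \<ge> 1"
    obtain J1 Q1 where J1: "J1 \<in> operators (ell2 n) X" and Q1: "Q1 \<in> operators X (ell2 n)"
      and QJ1: "\<And>y. y \<in> vcarrier (ell2 n) \<Longrightarrow> Q1 (J1 y) = y"
      and n1: "opnorm (ell2 n) X J1 \<le> K1" "opnorm X (ell2 n) Q1 \<le> K1"
      using JQ1[OF n] by blast
    obtain J2 Q2 where J2: "J2 \<in> operators (ell2 n) Y" and Q2: "Q2 \<in> operators Y (ell2 n)"
      and QJ2: "\<And>y. y \<in> vcarrier (ell2 n) \<Longrightarrow> Q2 (J2 y) = y"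
      and n2: "opnorm (ell2 n) Y J2 \<le> K2" "opnorm Y (ell2 n) Q2 \<le> K2"
      using JQ2[OF n] by blast
    let ?l = "ell2 n :: ('k, _) nspace"
    interpret l: normed_space ?l by (rule normed_space_ell2)
    interpret R: retraction X ?l J1 Q1
      by unfold_locales (use J1 Q1 QJ1 in auto)
    interpret Yl: normed_pair Y ?l ..
    interpret lY: normed_pair ?l Y ..
    note NX = X.normed_space_axioms and NY = Y.normed_space_axioms
      and Nl = l.normed_space_axioms and NH = R.H.normed_space_axioms
    let ?A = "compose (vcarrier X) J2 Q1" and ?B = "compose (vcarrier Y) J1 Q2"
      and ?I = "id_op R.H"
    have A: "?A \<in> operators X Y" using operators_compose[OF NX Nl NY Q1 J2] .
    have B: "?B \<in> operators Y R.H" using operators_compose[OF NY Nl NH Q2 R.J_operator_H] .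
    have "opnorm X Y ?A \<le> opnorm ?l Y J2 * opnorm X ?l Q1"
      using opnorm_compose[OF NX Nl NY Q1 J2] .
    also have "\<dots> \<le> K2 * K1"
      using n1 n2 K2 R.XL.opnorm_nonneg[OF Q1] by (intro mult_mono) auto
    finally have An: "opnorm X Y ?A \<le> K2 * K1" .
    \<comment> \<open>\<open>J1\<close> is viewed as a map into \<open>H\<close>, where it preserves
      norms, so only the norm of \<open>Q2\<close> enters.\<close>
    have "opnorm Y R.H ?B \<le> opnorm ?l R.H J1 * opnorm Y ?l Q2"
      using opnorm_compose[OF NY Nl NH Q2 R.J_operator_H] .
    also have "\<dots> \<le> 1 * K2"
      using n2 R.opnorm_J_H Yl.opnorm_nonneg[OF Q2] by (intro mult_mono) auto
    finally have Bn: "opnorm Y R.H ?B \<le> K2" by simp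
    have In: "opnorm R.H X ?I \<le> K1" using R.opnorm_inclusion n1 by simp
    have "?A \<in> finite_rank_operators X Y"
    proof -
      let ?e = "map (\<lambda>j i. if i = j then 1 else (0 :: 'k)) (rev [0..<n])"
      have e: "set ?e \<subseteq> vcarrier ?l" by (auto simp: ell2_def)
      have "J2 y \<in> fspan Y (map J2 ?e)" if "y \<in> vcarrier ?l" for y
        using lY.range_subset_fspan[OF J2 e] ell2_subset_fspan that by blast
      then have "?A ` vcarrier X \<subseteq> fspan Y (map J2 ?e)"
        using operatorsD(1)[OF Q1] by (auto simp: compose_def)
      moreover have "set (map J2 ?e) \<subseteq> vcarrier Y" using e operatorsD(1)[OF J2] by auto
      ultimately show ?thesis unfolding XY.finite_rank_iff using A by blast
    qed
    moreover have "1 \<le> K2 * K1 * s X Y ?A n"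
    proof -
      have I: "?I \<in> operators R.H X" by (rule R.inclusion)
      have AI: "compose (vcarrier R.H) ?A ?I \<in> operators R.H Y"
        using operators_compose[OF NH NX NY I A] .
      \<comment> \<open>\<open>Q2\<close> cancels \<open>J2\<close>, and \<open>J1\<close> after
        \<open>Q1\<close> is the identity on the range of \<open>J1\<close>.\<close>
      have "compose (vcarrier R.H) ?B (compose (vcarrier R.H) ?A ?I) = ?I"
        using R.H_subset operatorsD(1)[OF Q1] operatorsD(1)[OF J2]
        by (auto simp: compose_def fun_eq_iff QJ2 R.JQ)
      then have "1 = s R.H R.H (compose (vcarrier R.H) ?B (compose (vcarrier R.H) ?A ?I)) n"
        using s_ell2[OF R.banach_space_H R.isometric_H n] by simp
      \<comment> \<open>The outer factors enter with index 1, where the s-number is the norm, so the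
        index \<open>n\<close> stays with \<open>?A\<close>.\<close>
      also have "\<dots> \<le> s Y R.H ?B 1 * s R.H Y (compose (vcarrier R.H) ?A ?I) n"
        using s_mult[OF R.banach_space_H BY R.banach_space_H AI B _ n, of 1] by simp
      also have "\<dots> \<le> s Y R.H ?B 1 * (s X Y ?A n * s R.H X ?I 1)"
        using s_mult[OF R.banach_space_H BX BY I A n, of 1] s_nonneg[OF BY R.banach_space_H B, of 1]
        by (intro mult_left_mono) auto
      also have "\<dots> = (opnorm Y R.H ?B * opnorm R.H X ?I) * s X Y ?A n"
        using s_norm[OF BY R.banach_space_H B] s_norm[OF R.banach_space_H BX I] by simp
      also have "\<dots> \<le> (K2 * K1) * s X Y ?A n"
        using Bn In K2 R.HX.opnorm_nonneg[OF I] s_nonneg[OF BX BY A n]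
        by (intro mult_right_mono mult_mono) auto
      finally show ?thesis .
    qed
    ultimately show "\<exists>A\<in>finite_rank_operators X Y. opnorm X Y A \<le> K2 * K1 \<and> 1 \<le> K2 * K1 * s X Y A n"
      using An by blast
  qed
qed

end

section \<open>The Baire category argument for approximable operators\<close>

theorem theorem3p4:
  fixes s :: "('k::{real_normed_field,banach}, 'a) nspace \<Rightarrow> ('k, 'a) nspace
      \<Rightarrow> ('a \<Rightarrow> 'a) \<Rightarrow> nat \<Rightarrow> real"
    and X Y :: "('k, 'a) nspace"
    and \<epsilon> :: "nat \<Rightarrow> real"
  assumes "s_numbers_sequence s"
    and "banach_space X" and "banach_space Y"
    and "uniformly_complemented_ell2 X" and "uniformly_complemented_ell2 Y"
    and "\<epsilon> \<longlonglongrightarrow> 0"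
  shows "\<exists>T\<in>approximable_operators X Y. \<not> (\<exists>C. \<forall>n\<ge>1. s X Y T n \<le> C * \<bar>\<epsilon> n\<bar>)"
proof (rule ccontr)
  assume "\<not> ?thesis"
  then have big: "\<And>T. T \<in> approximable_operators X Y \<Longrightarrow> \<exists>C. \<forall>n\<ge>1. s X Y T n \<le> C * \<bar>\<epsilon> n\<bar>"
    by blast
  interpret s_numbers_sequence s by fact
  interpret X: banach_space X by fact
  interpret Y: banach_space Y by fact
  interpret XY: normed_pair X Y ..
  let ?L = "operator_space X Y" and ?R = "finite_rank_operators X Y"
  let ?M = "approximable_operators X Y"
  \<comment> \<open>Real constants are replaced by natural ones so that countably many sets cover
    \<open>?M\<close>.\<close>
  define F where "F m = {T \<in> operators X Y. \<forall>n\<ge>1. s X Y T n \<le> real m * \<bar>\<epsilon> n\<bar>}" for m :: nat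
  note Lsimps = XY.operator_space_simps
  have RL: "?R \<subseteq> operators X Y" by (auto simp: finite_rank_operators_def)
  have M_def: "?M = XY.L.M.mtopology closure_of ?R"
    by (simp add: approximable_operators_def Lsimps)
  have RM: "?R \<subseteq> ?M"
    unfolding M_def
    by (rule closure_of_subset) (use RL in \<open>unfold XY.L.M.topspace_mtopology, simp add: Lsimps\<close>)
  have M_L: "?M \<subseteq> operators X Y"
    using closure_of_subset_topspace[of XY.L.M.mtopology ?R]
    unfolding M_def XY.L.M.topspace_mtopology by (simp add: Lsimps)
  have complete: "XY.L.M.mcomplete"
    using XY.banach_space_operator_space[OF assms(3)] by (rule banach_space.complete)
  have cover: "?M \<subseteq> (\<Union>m. F m)"
  proof
    fix T assume T: "T \<in> ?M"
    then obtain C where C: "\<And>n. n \<ge> 1 \<Longrightarrow> s X Y T n \<le> C * \<bar>\<epsilon> n\<bar>" using big by blast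
    obtain m :: nat where "C \<le> real m" using real_arch_simple by blast
    then have "s X Y T n \<le> real m * \<bar>\<epsilon> n\<bar>" if "n \<ge> 1" for n
      using C[OF that] mult_right_mono[of C "real m" "\<bar>\<epsilon> n\<bar>"] by simp
    then show "T \<in> (\<Union>m. F m)" using T M_L by (auto simp: F_def)
  qed
  have "closedin XY.L.M.mtopology (F m)" for m
    using closedin_s_bounded[OF assms(2,3), of "\<lambda>n. real m * \<bar>\<epsilon> n\<bar>"] by (simp add: F_def Lsimps)
  moreover have "closedin XY.L.M.mtopology ?M" by (simp add: M_def)
  moreover have "?M \<noteq> {}" using RM XY.finite_rank_zero by blast
  \<comment> \<open>Only the part of the ball inside \<open>?M\<close> is controlled, so operators
    placed in the ball below must also be approximable; finite rank ensures this.\<close>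
  ultimately obtain m T1 r1 where T1: "T1 \<in> ?M" "r1 > 0" and ball1: "?M \<inter> XY.L.M.mball T1 r1 \<subseteq> F m"
    using XY.L.M.Baire_category_closedin[OF complete _ _ _ cover] by metis
  \<comment> \<open>Finite-rank operators are dense in \<open>?M\<close>, so the ball contains one;
    a smaller ball around it serves from here on.\<close>
  obtain T0 where T0: "T0 \<in> ?R" "T0 \<in> XY.L.M.mball T1 r1"
    using T1 unfolding M_def XY.L.M.metric_closure_of by blast
  obtain r where r: "r > 0" "XY.L.M.mball T0 r \<subseteq> XY.L.M.mball T1 r1"
    using T0(2) XY.L.M.openin_mball[of T1 r1] unfolding XY.L.M.openin_mtopology by blast
  have T0L: "T0 \<in> operators X Y" using T0 RL by blast
  have T0F: "T0 \<in> F m" using T0 RM ball1 by blast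
  obtain K where K: "K > 0" and large: "\<And>n. n \<ge> 1 \<Longrightarrow>
    \<exists>A\<in>?R. opnorm X Y A \<le> K \<and> 1 \<le> K * s X Y A n"
    using exists_finite_rank_s_large[OF assms(2-5)] by blast
  \<comment> \<open>With this choice \<open>t * K\<close> is \<open>r / 2\<close>, so adding
    \<open>t\<close> times an operator of norm at most \<open>K\<close> to \<open>T0\<close> stays
    inside the ball of radius \<open>r\<close>.\<close>
  define t where "t = r / (2 * K)"
  have t: "t > 0" using r K by (simp add: t_def)
  have lower: "t \<le> 2 * K * real m * \<bar>\<epsilon> j\<bar>" if j: "j \<ge> 1" for j
  proof -
    \<comment> \<open>Additivity yields the index \<open>j + j - 1\<close> from two summands of
      index \<open>j\<close>, so the test operator is taken for this index.\<close>
    have "j + j - 1 \<ge> 1" using j by simp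
    then obtain A where A: "A \<in> ?R" "opnorm X Y A \<le> K" "1 \<le> K * s X Y A (j + j - 1)"
      using large by blast
    have AL: "A \<in> operators X Y" using A RL by blast
    let ?S = "vscale ?L (of_real t) A"
    have S: "?S \<in> ?R" using XY.finite_rank_scale[OF A(1)] .
    then have SL: "?S \<in> operators X Y" using RL by blast
    let ?T = "vadd ?L T0 ?S"
    have T: "?T \<in> ?R" using XY.finite_rank_add[OF T0(1) S] .
    then have TL: "?T \<in> operators X Y" using RL by blast
    have "opnorm X Y ?S = t * opnorm X Y A"
      using XY.L.norm_scale[of A "of_real t"] AL t by (simp add: Lsimps)
    also have "\<dots> \<le> t * K" using A(2) t by simp
    also have "\<dots> < r" using r K by (simp add: t_def)
    finally have "vdist ?L T0 ?T < r"
      using T0L TL SL XY.L.norm_sub_commute[of T0 ?T] XY.L.add_sub_cancel[of T0 ?S]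
      by (simp add: vdist_def Lsimps)
    then have "?T \<in> XY.L.M.mball T0 r" using T0L TL unfolding XY.L.M.in_mball by (simp add: Lsimps)
    then have TF: "?T \<in> F m" using T RM r ball1 by blast
    \<comment> \<open>Both \<open>?T\<close> and \<open>T0\<close> lie in \<open>F m\<close>, so
      this difference has its s-number of index \<open>j + j - 1\<close> bounded by twice the common
      bound at \<open>j\<close>.\<close>
    have ST: "?S = vadd ?L ?T (vscale ?L (- 1) T0)"
      using XY.L.add_sub_cancel[of T0 ?S] T0L SL by (simp add: Lsimps)
    have mT0: "vscale ?L (- 1) T0 \<in> operators X Y" using XY.L.scale_closed T0L by (simp add: Lsimps)
    have "s X Y ?S (j + j - 1) \<le> s X Y ?T j + s X Y (vscale ?L (- 1) T0) j"
      using s_add[OF assms(2,3) mT0 TL j j] ST by simp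
    also have "\<dots> \<le> s X Y ?T j + s X Y T0 j"
      using s_scale[OF assms(2,3) T0L j, of "- 1"] by simp
    also have "\<dots> \<le> 2 * real m * \<bar>\<epsilon> j\<bar>" using T0F TF j by (force simp: F_def)
    finally have Sle: "s X Y ?S (j + j - 1) \<le> 2 * real m * \<bar>\<epsilon> j\<bar>" .
    \<comment> \<open>\<open>s_scale\<close> bounds scaled operators only from above, so
      \<open>A\<close> is recovered from \<open>?S\<close> by the inverse factor.\<close>
    have "vscale ?L (inverse (of_real t)) ?S = A"
      using XY.L.scale_scale[of A "inverse (of_real t)" "of_real t"] XY.L.scale_one[of A] AL t
      by (simp add: Lsimps)
    then have "s X Y A (j + j - 1) \<le> inverse t * s X Y ?S (j + j - 1)"
      using s_scale[OF assms(2,3) SL \<open>j + j - 1 \<ge> 1\<close>, of "inverse (of_real t)"] t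
      by (simp add: norm_inverse)
    also have "\<dots> \<le> inverse t * (2 * real m * \<bar>\<epsilon> j\<bar>)" using Sle t by simp
    finally have "K * s X Y A (j + j - 1) \<le> K * (inverse t * (2 * real m * \<bar>\<epsilon> j\<bar>))"
      using K by simp
    then have "1 \<le> K * (inverse t * (2 * real m * \<bar>\<epsilon> j\<bar>))" using A(3) by linarith
    then show ?thesis using t by (simp add: field_simps)
  qed
  \<comment> \<open>The right-hand side of \<open>lower\<close> tends to 0, while \<open>t\<close>
    does not depend on \<open>j\<close>.\<close>
  have "(\<lambda>j. 2 * K * real m * \<bar>\<epsilon> j\<bar>) \<longlonglongrightarrow> 0"
    using tendsto_rabs_zero[OF assms(6)] by (rule tendsto_mult_right_zero)
  then have "t \<le> 0"
    by (rule LIMSEQ_le_const) (use lower in blast)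
  then show False using t by simp
qed

end
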